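(* Let $\xi\in\mathbb C/2\mathbb Z$ and $\tau\in\mathbb C$, and fix a square root $\sqrt\tau$. The dense $\mathfrak{sl}(2)$-module $\mathbb V(\xi,\tau)$ does not admit a compatible structure of $\mathbf{Witt}$-module (resp. $\mathbf{Vir}$-module) if and only if the roots of the polynomial $(x-1)^2-\tau$ (that is, both $1+\sqrt\tau$ and $1-\sqrt\tau$) lie in $\xi$. For each choice of sign, if the root $1\mp\sqrt\tau$ does not lie in $\xi$, then $\mathbb V(\xi,\tau)$ is a $\mathbf{Witt}$-module (resp. $\mathbf{Vir}$-module), compatibly with its $\mathfrak{sl}(2)$-structure, via $$\rho^{\pm}(L_i)v_\mu=\Big(\frac{(-1)^i}{2}\big(i(\pm\sqrt\tau-1)-\mu\big)\,P\big(\tfrac12(1+\mu\pm\sqrt\tau),i\big)\Big)v_{\mu+2i},\qquad i\in\mathbb Z,\ \mu\in\xi$$ (and $\rho^{\pm}(C)=0$ in the case of $\mathbf{Vir}$). In particular, if $\mathbb V(\xi,\tau)$ is simple, then it carries exactly two such structures for $\tau\ne0,1$ and exactly one for $\tau=0,1$.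
   Context: $\mathfrak{sl}(2)=\mathfrak{sl}(2,\mathbb C)$ has Chevalley basis $\{e,f,h\}$ with $[e,f]=h$, $[h,e]=2e$, $[h,f]=-2f$. $\mathbf{Witt}$ is the complex Lie algebra with basis $\{L_k\}_{k\in\mathbb Z}$ and bracket $[L_i,L_j]=(i-j)L_{i+j}$; $\mathbf{Vir}$ has basis $\{L_k\}_{k\in\mathbb Z}\cup\{C\}$ with $[L_i,L_j]=(i-j)L_{i+j}+\frac1{12}(i^3-i)\delta_{i+j,0}C$ and $C$ central. $\mathfrak{sl}(2)$ is embedded in both by $f\mapsto L_{-1}$, $h\mapsto-2L_0$, $e\mapsto-L_1$; a module structure is compatible if its restriction along this embedding is the given $\mathfrak{sl}(2)$-structure. A class $\xi\in\mathbb C/2\mathbb Z$ is regarded as a subset of $\mathbb C$. The dense module $\mathbb V(\xi,\tau)$ is the vector space with basis $\{v_\mu:\mu\in\xi\}$ and action $f v_\mu=v_{\mu-2}$, $h v_\mu=\mu v_\mu$, $e v_\mu=\frac14(\tau-(\mu+1)^2)v_{\mu+2}$; it is simple if and only if $\tau\neq(\mu+1)^2$ for all $\mu\in\xi$. The Pochhammer symbol is $P(z,n)=z(z+1)\cdots(z+n-1)$ for $n\ge0$ and $P(z,n)=\frac1{(z+n)(z+n+1)\cdots(z-1)}$ for $n\le-1$. *)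

theory Defs
  imports Complex_Main "HOL-Library.Poly_Mapping" "HOL-Library.FuncSet"
begin

section \<open>Vector spaces with a given basis\<close>

text \<open>
  The complex vector space with basis a type \<open>'b\<close> is the type \<open>'b \<Rightarrow>\<^sub>0 complex\<close> of finitely
  supported functions; \<open>single b 1\<close> is the basis vector with index \<open>b\<close>.
\<close>

lift_definition pm_scale :: "complex \<Rightarrow> ('b \<Rightarrow>\<^sub>0 complex) \<Rightarrow> ('b \<Rightarrow>\<^sub>0 complex)"
    (infixr \<open>*\<^sub>C\<close> 75)
  is "\<lambda>c f b. c * f b"
  by (rule finite_subset) auto

abbreviation basis_vec :: "'b \<Rightarrow> ('b \<Rightarrow>\<^sub>0 complex)" where
  "basis_vec b \<equiv> Poly_Mapping.single b 1"

definition lin_ext :: "('a \<Rightarrow> ('b \<Rightarrow>\<^sub>0 complex)) \<Rightarrow> ('a \<Rightarrow>\<^sub>0 complex) \<Rightarrow> ('b \<Rightarrow>\<^sub>0 complex)" where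
  "lin_ext m x = (\<Sum>a\<in>Poly_Mapping.keys x. Poly_Mapping.lookup x a *\<^sub>C m a)"

definition bilin_ext ::
    "('a \<Rightarrow> 'b \<Rightarrow> ('c \<Rightarrow>\<^sub>0 complex)) \<Rightarrow> ('a \<Rightarrow>\<^sub>0 complex) \<Rightarrow> ('b \<Rightarrow>\<^sub>0 complex) \<Rightarrow> ('c \<Rightarrow>\<^sub>0 complex)" where
  "bilin_ext m x y = lin_ext (\<lambda>a. lin_ext (m a) y) x"

lemma lookup_pm_scale [simp]: "Poly_Mapping.lookup (c *\<^sub>C x) b = c * Poly_Mapping.lookup x b"
  by transfer simp

lemma pm_scale_add_right: "c *\<^sub>C (x + y) = c *\<^sub>C x + c *\<^sub>C y"
  by (rule poly_mapping_eqI) (simp add: lookup_add algebra_simps)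

lemma pm_scale_add_left: "(c + d) *\<^sub>C x = c *\<^sub>C x + d *\<^sub>C x"
  by (rule poly_mapping_eqI) (simp add: lookup_add algebra_simps)

lemma pm_scale_minus_right: "c *\<^sub>C (- x) = - (c *\<^sub>C x)"
  by (rule poly_mapping_eqI) simp

lemma pm_scale_diff_right: "c *\<^sub>C (x - y) = c *\<^sub>C x - c *\<^sub>C y"
  by (rule poly_mapping_eqI) (simp add: lookup_minus algebra_simps)

lemma pm_scale_scale [simp]: "c *\<^sub>C d *\<^sub>C x = (c * d) *\<^sub>C x"
  by (rule poly_mapping_eqI) (simp add: algebra_simps)

lemma pm_scale_simps [simp]:
  "c *\<^sub>C 0 = 0" "0 *\<^sub>C x = 0" "1 *\<^sub>C x = x"
  "c *\<^sub>C Poly_Mapping.single b d = Poly_Mapping.single b (c * d)"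
  by (auto intro!: poly_mapping_eqI simp: lookup_single when_def)

lemma pm_scale_sum: "c *\<^sub>C (\<Sum>i\<in>I. g i) = (\<Sum>i\<in>I. c *\<^sub>C g i)"
  by (induction I rule: infinite_finite_induct) (simp_all add: pm_scale_add_right)

interpretation pm: vector_space "pm_scale :: complex \<Rightarrow> ('b \<Rightarrow>\<^sub>0 complex) \<Rightarrow> _"
  by unfold_locales (simp_all add: pm_scale_add_right pm_scale_add_left)

lemma lin_ext_superset:
  assumes "finite A" "Poly_Mapping.keys x \<subseteq> A"
  shows "lin_ext m x = (\<Sum>a\<in>A. Poly_Mapping.lookup x a *\<^sub>C m a)"
  unfolding lin_ext_def
  by (rule sum.mono_neutral_left) (use assms in \<open>auto simp: in_keys_iff\<close>)

lemma lin_ext_add: "lin_ext m (x + y) = lin_ext m x + lin_ext m y"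
proof -
  let ?A = "Poly_Mapping.keys x \<union> Poly_Mapping.keys y"
  have "lin_ext m (x + y) = (\<Sum>a\<in>?A. Poly_Mapping.lookup (x + y) a *\<^sub>C m a)"
    by (rule lin_ext_superset) (use keys_add[of x y] in auto)
  also have "\<dots> = (\<Sum>a\<in>?A. Poly_Mapping.lookup x a *\<^sub>C m a)
      + (\<Sum>a\<in>?A. Poly_Mapping.lookup y a *\<^sub>C m a)"
    by (simp add: lookup_add pm_scale_add_left sum.distrib)
  also have "\<dots> = lin_ext m x + lin_ext m y"
    by (simp add: lin_ext_superset[of ?A])
  finally show ?thesis .
qed

lemma lin_ext_scale: "lin_ext m (c *\<^sub>C x) = c *\<^sub>C lin_ext m x"
proof -
  have "lin_ext m (c *\<^sub>C x)
      = (\<Sum>a\<in>Poly_Mapping.keys x. Poly_Mapping.lookup (c *\<^sub>C x) a *\<^sub>C m a)"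
    by (rule lin_ext_superset) (auto simp: in_keys_iff)
  also have "\<dots> = c *\<^sub>C lin_ext m x"
    by (simp add: lin_ext_def pm_scale_sum)
  finally show ?thesis .
qed

lemma lin_ext_zero [simp]: "lin_ext m 0 = 0"
  by (simp add: lin_ext_def)

lemma lin_ext_single [simp]: "lin_ext m (Poly_Mapping.single b c) = c *\<^sub>C m b"
  by (cases "c = 0") (simp_all add: lin_ext_def)

lemma lin_ext_fun_add: "lin_ext (\<lambda>a. m a + n a) x = lin_ext m x + lin_ext n x"
  by (simp add: lin_ext_def pm_scale_add_right sum.distrib)

lemma lin_ext_fun_scale: "lin_ext (\<lambda>a. c *\<^sub>C m a) x = c *\<^sub>C lin_ext m x"
  by (simp add: lin_ext_def pm_scale_sum mult.commute)

lemma lin_ext_fun_zero [simp]: "lin_ext (\<lambda>a. 0) x = 0"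
  by (simp add: lin_ext_def)

lemma bilin_ext_linear:
  "bilin_ext m (x + x') y = bilin_ext m x y + bilin_ext m x' y"
  "bilin_ext m x (y + y') = bilin_ext m x y + bilin_ext m x y'"
  "bilin_ext m (c *\<^sub>C x) y = c *\<^sub>C bilin_ext m x y"
  "bilin_ext m x (c *\<^sub>C y) = c *\<^sub>C bilin_ext m x y"
  by (simp_all add: bilin_ext_def lin_ext_add lin_ext_scale lin_ext_fun_add lin_ext_fun_scale)

lemma bilin_ext_simps [simp]:
  "bilin_ext m 0 y = 0"
  "bilin_ext m x 0 = 0"
  "bilin_ext m (Poly_Mapping.single a c) (Poly_Mapping.single b d) = (c * d) *\<^sub>C m a b"
  by (simp_all add: bilin_ext_def)

lemma pm_induct [case_names zero single add]:
  assumes "P 0" "\<And>k c. c \<noteq> 0 \<Longrightarrow> k \<in> Poly_Mapping.keys x \<Longrightarrow> P (Poly_Mapping.single k c)"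
    "\<And>a b. P a \<Longrightarrow> P b \<Longrightarrow> P (a + b)"
  shows "P (x :: 'b \<Rightarrow>\<^sub>0 complex)"
proof -
  have "lin_ext basis_vec x = x"
    by (rule poly_mapping_eqI)
       (simp add: lin_ext_def lookup_sum lookup_single when_def in_keys_iff if_distrib cong: if_cong)
  moreover have "P (\<Sum>a\<in>A. Poly_Mapping.lookup x a *\<^sub>C basis_vec a)"
    if "A \<subseteq> Poly_Mapping.keys x" for A
    using finite_subset[OF that finite_keys] that
    by (induction A rule: finite_induct) (auto intro!: assms simp: in_keys_iff)
  ultimately show ?thesis
    by (metis lin_ext_def subset_refl)
qed

section \<open>Complex Lie algebras and their modules\<close>

locale lie_algebra = vector_space scale
  for scale :: "complex \<Rightarrow> 'g :: ab_group_add \<Rightarrow> 'g" (infixr \<open>*s\<close> 75) +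
  fixes bracket :: "'g \<Rightarrow> 'g \<Rightarrow> 'g"
  assumes bracket_add_left: "bracket (x + x') y = bracket x y + bracket x' y"
    and bracket_add_right: "bracket x (y + y') = bracket x y + bracket x y'"
    and bracket_scale_left: "bracket (c *s x) y = c *s bracket x y"
    and bracket_scale_right: "bracket x (c *s y) = c *s bracket x y"
    and bracket_self: "bracket x x = 0"
    and jacobi: "bracket x (bracket y z) + bracket y (bracket z x) + bracket z (bracket x y) = 0"

text \<open>
  The underlying space of a module is a subspace \<open>V\<close> of the ambient vector space; the values of
  the action outside \<open>V\<close> are irrelevant.
\<close>

locale lie_module = lie_algebra scale bracket + M: vector_space mscale
  for scale :: "complex \<Rightarrow> 'g :: ab_group_add \<Rightarrow> 'g"
    and bracket :: "'g \<Rightarrow> 'g \<Rightarrow> 'g"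
    and mscale :: "complex \<Rightarrow> 'v :: ab_group_add \<Rightarrow> 'v" +
  fixes V :: "'v set" and act :: "'g \<Rightarrow> 'v \<Rightarrow> 'v"
  assumes subspace: "M.subspace V"
    and act_closed: "v \<in> V \<Longrightarrow> act x v \<in> V"
    and act_add: "v \<in> V \<Longrightarrow> w \<in> V \<Longrightarrow> act x (v + w) = act x v + act x w"
    and act_scale: "v \<in> V \<Longrightarrow> act x (mscale c v) = mscale c (act x v)"
    and act_add_left: "v \<in> V \<Longrightarrow> act (x + y) v = act x v + act y v"
    and act_scale_left: "v \<in> V \<Longrightarrow> act (scale c x) v = mscale c (act x v)"
    and act_bracket: "v \<in> V \<Longrightarrow> act (bracket x y) v = act x (act y v) - act y (act x v)"

definition simple_lie_module ::
    "(complex \<Rightarrow> 'g :: ab_group_add \<Rightarrow> 'g) \<Rightarrow> ('g \<Rightarrow> 'g \<Rightarrow> 'g) \<Rightarrow>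
     (complex \<Rightarrow> 'v :: ab_group_add \<Rightarrow> 'v) \<Rightarrow> 'v set \<Rightarrow> ('g \<Rightarrow> 'v \<Rightarrow> 'v) \<Rightarrow> bool" where
  "simple_lie_module scale bracket mscale V act \<longleftrightarrow>
     lie_module scale bracket mscale V act \<and> V \<noteq> {0} \<and>
     (\<forall>W \<subseteq> V. lie_module scale bracket mscale W act \<longrightarrow> W = {0} \<or> W = V)"

lemma bilin_ext_lie_algebra:
  fixes m :: "'b \<Rightarrow> 'b \<Rightarrow> ('b \<Rightarrow>\<^sub>0 complex)"
  assumes self: "\<And>a. m a a = 0" and anti: "\<And>a b. m a b = - m b a"
    and jac: "\<And>a b c. lin_ext (m a) (m b c) + lin_ext (m b) (m c a) + lin_ext (m c) (m a b) = 0"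
  shows "lie_algebra pm_scale (bilin_ext m)"
proof
  have anti': "bilin_ext m x y = - bilin_ext m y x" for x y
  proof (induction x rule: pm_induct)
    case (single a c)
    show ?case
    proof (induction y rule: pm_induct)
      case (single b d)
      show ?case
        by (simp add: anti[of a b] pm_scale_minus_right mult.commute)
    qed (simp_all add: bilin_ext_linear)
  qed (simp_all add: bilin_ext_linear)
  show "bilin_ext m x x = 0" for x
  proof (induction x rule: pm_induct)
    case (add a b)
    then show ?case
      using anti'[of a b] by (simp add: bilin_ext_linear)
  qed (simp_all add: self)
  have single: "bilin_ext m (Poly_Mapping.single a c) y = c *\<^sub>C lin_ext (m a) y" for a c y
    by (simp add: bilin_ext_def)
  show "bilin_ext m x (bilin_ext m y z) + bilin_ext m y (bilin_ext m z x)
      + bilin_ext m z (bilin_ext m x y) = 0" (is "?J x y z = 0") for x y z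
  proof (induction x rule: pm_induct)
    case (single a c)
    show ?case
    proof (induction y rule: pm_induct)
      case (single b d)
      show ?case
      proof (induction z rule: pm_induct)
        case (single k r)
        have "?J (Poly_Mapping.single a c) (Poly_Mapping.single b d) (Poly_Mapping.single k r)
          = (c * d * r) *\<^sub>C (lin_ext (m a) (m b k) + lin_ext (m b) (m k a) + lin_ext (m k) (m a b))"
          by (simp add: bilin_ext_linear bilin_ext_def lin_ext_scale pm_scale_add_right mult_ac)
        then show ?case
          by (simp add: jac)
      next
        case (add u v)
        have "?J (Poly_Mapping.single a c) (Poly_Mapping.single b d) (u + v)
          = ?J (Poly_Mapping.single a c) (Poly_Mapping.single b d) u
          + ?J (Poly_Mapping.single a c) (Poly_Mapping.single b d) v"
          by (simp add: bilin_ext_linear pm_scale_add_right)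
        then show ?case using add by simp
      qed simp
    next
      case (add u v)
      have "?J (Poly_Mapping.single a c) (u + v) z
        = ?J (Poly_Mapping.single a c) u z + ?J (Poly_Mapping.single a c) v z"
        by (simp add: bilin_ext_linear pm_scale_add_right)
      then show ?case using add by simp
    qed simp
  next
    case (add u v)
    have "?J (u + v) y z = ?J u y z + ?J v y z"
      by (simp add: bilin_ext_linear)
    then show ?case using add by simp
  qed simp
qed (simp_all add: bilin_ext_linear)

lemma bilin_ext_lie_module:
  fixes m :: "'a \<Rightarrow> 'a \<Rightarrow> ('a \<Rightarrow>\<^sub>0 complex)" and n :: "'a \<Rightarrow> 'b \<Rightarrow> ('b \<Rightarrow>\<^sub>0 complex)"
  assumes lie: "lie_algebra pm_scale (bilin_ext m)"
    and closed: "\<And>a b. b \<in> S \<Longrightarrow> Poly_Mapping.keys (n a b) \<subseteq> S"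
    and rep: "\<And>a a' b. b \<in> S \<Longrightarrow>
      lin_ext (\<lambda>c. n c b) (m a a') = lin_ext (n a) (n a' b) - lin_ext (n a') (n a b)"
  shows "lie_module pm_scale (bilin_ext m) pm_scale {v. Poly_Mapping.keys v \<subseteq> S} (bilin_ext n)"
proof -
  interpret lie_algebra pm_scale "bilin_ext m" by (fact lie)
  have sub: "pm.subspace {v :: 'b \<Rightarrow>\<^sub>0 complex. Poly_Mapping.keys v \<subseteq> S}"
    by (rule pm.subspaceI)
       (auto dest: subsetD[OF keys_add] simp: in_keys_iff)
  show ?thesis
  proof
    fix x :: "'a \<Rightarrow>\<^sub>0 complex" and v :: "'b \<Rightarrow>\<^sub>0 complex"
    assume v: "v \<in> {v. Poly_Mapping.keys v \<subseteq> S}"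
    have "lin_ext (n a) v \<in> {v. Poly_Mapping.keys v \<subseteq> S}" for a
      unfolding lin_ext_def using v closed
      by (intro pm.subspace_sum[OF sub] pm.subspace_scale[OF sub]) auto
    then show "bilin_ext n x v \<in> {v. Poly_Mapping.keys v \<subseteq> S}"
      unfolding bilin_ext_def lin_ext_def[of _ x]
      by (intro pm.subspace_sum[OF sub] pm.subspace_scale[OF sub]) auto
  next
    fix x y :: "'a \<Rightarrow>\<^sub>0 complex" and v :: "'b \<Rightarrow>\<^sub>0 complex"
    assume v: "v \<in> {v. Poly_Mapping.keys v \<subseteq> S}"
    let ?P = "\<lambda>x y v. bilin_ext n (bilin_ext m x y) v
      = bilin_ext n x (bilin_ext n y v) - bilin_ext n y (bilin_ext n x v)"
    show "?P x y v"
    proof (induction x rule: pm_induct)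
      case (single a c)
      show ?case
      proof (induction y rule: pm_induct)
        case (single a' c')
        show ?case
        proof (induction v rule: pm_induct)
          case (single b d)
          then have "b \<in> S" using v by auto
          have "?P (Poly_Mapping.single a c) (Poly_Mapping.single a' c') (d *\<^sub>C basis_vec b)"
            unfolding bilin_ext_linear
            by (simp add: bilin_ext_def lin_ext_scale lin_ext_fun_scale rep[OF \<open>b \<in> S\<close>]
                pm_scale_diff_right mult_ac)
          then show ?case
            by simp
        qed (simp_all add: bilin_ext_linear)
      qed (simp_all add: bilin_ext_linear)
    qed (simp_all add: bilin_ext_linear)
  qed (use sub in \<open>simp_all add: bilin_ext_linear\<close>)
qed

lemma lin_ext_hom:
  assumes "\<And>a b. lin_ext \<phi> (m a b) = bilin_ext n (\<phi> a) (\<phi> b)"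
  shows "lin_ext \<phi> (bilin_ext m x y) = bilin_ext n (lin_ext \<phi> x) (lin_ext \<phi> y)"
proof (induction x rule: pm_induct)
  case (single a c)
  show ?case
    by (induction y rule: pm_induct)
       (simp_all add: bilin_ext_linear lin_ext_add lin_ext_scale assms)
qed (simp_all add: bilin_ext_linear lin_ext_add)

section \<open>The Lie algebras \<open>sl(2)\<close>, Witt and Virasoro\<close>

datatype sl2_basis = Sl_e | Sl_f | Sl_h

type_synonym sl2 = "sl2_basis \<Rightarrow>\<^sub>0 complex"

fun sl2_basis_bracket :: "sl2_basis \<Rightarrow> sl2_basis \<Rightarrow> sl2" where
  "sl2_basis_bracket Sl_e Sl_f = basis_vec Sl_h"
| "sl2_basis_bracket Sl_f Sl_e = - basis_vec Sl_h"
| "sl2_basis_bracket Sl_h Sl_e = 2 *\<^sub>C basis_vec Sl_e"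
| "sl2_basis_bracket Sl_e Sl_h = - (2 *\<^sub>C basis_vec Sl_e)"
| "sl2_basis_bracket Sl_h Sl_f = - (2 *\<^sub>C basis_vec Sl_f)"
| "sl2_basis_bracket Sl_f Sl_h = 2 *\<^sub>C basis_vec Sl_f"
| "sl2_basis_bracket Sl_e Sl_e = 0"
| "sl2_basis_bracket Sl_f Sl_f = 0"
| "sl2_basis_bracket Sl_h Sl_h = 0"

definition sl2_bracket :: "sl2 \<Rightarrow> sl2 \<Rightarrow> sl2" where
  "sl2_bracket = bilin_ext sl2_basis_bracket"

text \<open>In \<open>witt\<close> the basis vector with index \<open>i\<close> is \<open>L\<^sub>i\<close>.\<close>

type_synonym witt = "int \<Rightarrow>\<^sub>0 complex"

definition witt_bracket :: "witt \<Rightarrow> witt \<Rightarrow> witt" where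
  "witt_bracket = bilin_ext (\<lambda>i j. of_int (i - j) *\<^sub>C basis_vec (i + j))"

datatype vir_basis = Vir_L int | Vir_C

type_synonym vir = "vir_basis \<Rightarrow>\<^sub>0 complex"

fun vir_basis_bracket :: "vir_basis \<Rightarrow> vir_basis \<Rightarrow> vir" where
  "vir_basis_bracket (Vir_L i) (Vir_L j) =
     of_int (i - j) *\<^sub>C basis_vec (Vir_L (i + j)) +
     (if i + j = 0 then (of_int (i ^ 3 - i) / 12) *\<^sub>C basis_vec Vir_C else 0)"
| "vir_basis_bracket Vir_C _ = 0"
| "vir_basis_bracket _ Vir_C = 0"

definition vir_bracket :: "vir \<Rightarrow> vir \<Rightarrow> vir" where
  "vir_bracket = bilin_ext vir_basis_bracket"

definition sl2_to_witt :: "sl2 \<Rightarrow> witt" where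
  "sl2_to_witt = lin_ext (\<lambda>b. case b of
     Sl_f \<Rightarrow> basis_vec (-1) | Sl_h \<Rightarrow> (-2) *\<^sub>C basis_vec 0 | Sl_e \<Rightarrow> - basis_vec 1)"

definition sl2_to_vir :: "sl2 \<Rightarrow> vir" where
  "sl2_to_vir = lin_ext (\<lambda>b. case b of
     Sl_f \<Rightarrow> basis_vec (Vir_L (-1)) | Sl_h \<Rightarrow> (-2) *\<^sub>C basis_vec (Vir_L 0)
   | Sl_e \<Rightarrow> - basis_vec (Vir_L 1))"

lemma single_uminus: "- Poly_Mapping.single b c = Poly_Mapping.single b (- c)"
  for c :: complex
  by (simp add: single_uminus)

lemma sl2_lie_algebra: "lie_algebra pm_scale sl2_bracket"
  unfolding sl2_bracket_def
proof (rule bilin_ext_lie_algebra)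
  fix a b c
  show "sl2_basis_bracket a a = 0" by (cases a) auto
  show "sl2_basis_bracket a b = - sl2_basis_bracket b a" by (cases a; cases b) auto
  show "lin_ext (sl2_basis_bracket a) (sl2_basis_bracket b c)
      + lin_ext (sl2_basis_bracket b) (sl2_basis_bracket c a)
      + lin_ext (sl2_basis_bracket c) (sl2_basis_bracket a b) = 0"
    by (cases a; cases b; cases c) (simp_all add: single_uminus flip: single_add)
qed

lemma witt_lie_algebra: "lie_algebra pm_scale witt_bracket"
  unfolding witt_bracket_def
  by (rule bilin_ext_lie_algebra)
     (simp_all add: single_uminus add_ac algebra_simps flip: single_add)

lemma vir_lie_algebra: "lie_algebra pm_scale vir_bracket"
  unfolding vir_bracket_def
proof (rule bilin_ext_lie_algebra)
  have odd: "((- x) ^ 3 - (- x)) = - (x ^ 3 - x)" for x :: int by simp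
  fix a b c
  show "vir_basis_bracket a a = 0"
    by (cases a) auto
  show "vir_basis_bracket a b = - vir_basis_bracket b a"
  proof (cases a; cases b)
    fix i j assume [simp]: "a = Vir_L i" "b = Vir_L j"
    show ?thesis
    proof (cases "i + j = 0")
      case True
      then have [simp]: "j = - i" by simp
      show ?thesis
        by (simp add: single_uminus algebra_simps add_divide_distrib diff_divide_distrib)
    qed (simp add: single_uminus add.commute)
  qed auto
  show "lin_ext (vir_basis_bracket a) (vir_basis_bracket b c)
      + lin_ext (vir_basis_bracket b) (vir_basis_bracket c a)
      + lin_ext (vir_basis_bracket c) (vir_basis_bracket a b) = 0"
  proof (cases a; cases b; cases c)
    fix i j k assume [simp]: "a = Vir_L i" "b = Vir_L j" "c = Vir_L k"
    have L: "of_int (j - k) * of_int (i - (j + k)) + of_int (k - i) * of_int (j - (k + i))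
        + of_int (i - j) * of_int (k - (i + j)) = (0 :: complex)"
      by (simp add: algebra_simps)
    show ?thesis
    proof (cases "i + j + k = 0")
      case True
      have triple: "lin_ext (vir_basis_bracket (Vir_L p)) (vir_basis_bracket (Vir_L q) (Vir_L r))
          = Poly_Mapping.single (Vir_L 0) (of_int ((q - r) * (p - (q + r))))
          + Poly_Mapping.single Vir_C (of_int ((q - r) * (p ^ 3 - p)) / 12)"
        if "p + q + r = 0" for p q r
        using that by (simp add: lin_ext_add pm_scale_add_right add.assoc)
      have P: "(j - k) * (i - (j + k)) + (k - i) * (j - (k + i)) + (i - j) * (k - (i + j)) = 0"
        by (simp add: algebra_simps)
      have k: "k = - i - j"
        using True by simp
      have Q: "(j - k) * (i ^ 3 - i) + (k - i) * (j ^ 3 - j) + (i - j) * (k ^ 3 - k) = 0"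
        unfolding k by (simp add: algebra_simps power3_eq_cube)
      have "Poly_Mapping.single u (of_int p) + Poly_Mapping.single v (of_int p' / 12)
          + (Poly_Mapping.single u (of_int q) + Poly_Mapping.single v (of_int q' / 12))
          + (Poly_Mapping.single u (of_int r) + Poly_Mapping.single v (of_int r' / 12))
          = Poly_Mapping.single u (of_int (p + q + r))
          + Poly_Mapping.single v (of_int (p' + q' + r') / 12 :: complex)"
        for u v :: vir_basis and p q r p' q' r' :: int
        by (simp add: single_add add_divide_distrib add_ac)
      moreover have "i + j + k = 0" "j + k + i = 0" "k + i + j = 0"
        using True by simp_all
      ultimately show ?thesis
        by (simp only: triple P Q \<open>a = _\<close> \<open>b = _\<close> \<open>c = _\<close>) simp
    next
      case False
      then have "i + (j + k) \<noteq> 0" "j + (k + i) \<noteq> 0" "k + (i + j) \<noteq> 0" by linarith+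
      then show ?thesis
        using L by (simp add: lin_ext_add add_ac flip: single_add)
    qed
  qed (auto simp: lin_ext_add)
qed

lemma sl2_to_witt_hom:
  "sl2_to_witt (sl2_bracket x y) = witt_bracket (sl2_to_witt x) (sl2_to_witt y)"
  unfolding sl2_to_witt_def sl2_bracket_def witt_bracket_def
proof (rule lin_ext_hom)
  show "lin_ext (case_sl2_basis (- basis_vec 1) (basis_vec (- 1)) ((-2) *\<^sub>C basis_vec 0))
      (sl2_basis_bracket a b)
    = bilin_ext (\<lambda>i j. of_int (i - j) *\<^sub>C basis_vec (i + j))
        (case a of Sl_f \<Rightarrow> basis_vec (-1) | Sl_h \<Rightarrow> (-2) *\<^sub>C basis_vec 0 | Sl_e \<Rightarrow> - basis_vec 1)
        (case b of Sl_f \<Rightarrow> basis_vec (-1) | Sl_h \<Rightarrow> (-2) *\<^sub>C basis_vec 0 | Sl_e \<Rightarrow> - basis_vec 1)"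
    for a b
    by (cases a; cases b) (simp_all add: single_uminus del: single_one single_numeral)
qed

lemma sl2_to_vir_hom:
  "sl2_to_vir (sl2_bracket x y) = vir_bracket (sl2_to_vir x) (sl2_to_vir y)"
  unfolding sl2_to_vir_def sl2_bracket_def vir_bracket_def
proof (rule lin_ext_hom)
  show "lin_ext (case_sl2_basis (- basis_vec (Vir_L 1)) (basis_vec (Vir_L (- 1)))
        ((-2) *\<^sub>C basis_vec (Vir_L 0))) (sl2_basis_bracket a b)
    = bilin_ext vir_basis_bracket
        (case a of Sl_f \<Rightarrow> basis_vec (Vir_L (-1)) | Sl_h \<Rightarrow> (-2) *\<^sub>C basis_vec (Vir_L 0)
          | Sl_e \<Rightarrow> - basis_vec (Vir_L 1))
        (case b of Sl_f \<Rightarrow> basis_vec (Vir_L (-1)) | Sl_h \<Rightarrow> (-2) *\<^sub>C basis_vec (Vir_L 0)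
          | Sl_e \<Rightarrow> - basis_vec (Vir_L 1))"
    for a b
    by (cases a; cases b) (simp_all add: single_uminus)
qed

section \<open>Dense modules\<close>

definition C_mod_2Z :: "complex set set" where
  "C_mod_2Z = UNIV // {(a, b). \<exists>k :: int. a - b = 2 * of_int k}"

text \<open>
  \<open>V(\<xi>, \<tau>)\<close> has underlying space \<open>dense_space \<xi>\<close>, the span of the \<open>v\<^sub>\<mu>\<close> with \<open>\<mu> \<in> \<xi>\<close> inside the
  space with basis \<open>(v\<^sub>\<mu>)\<close>, \<open>\<mu>\<close> ranging over all complex numbers; \<open>v\<^sub>\<mu>\<close> is \<open>basis_vec \<mu>\<close>.
\<close>

definition dense_space :: "complex set \<Rightarrow> (complex \<Rightarrow>\<^sub>0 complex) set" where
  "dense_space \<xi> = {v. Poly_Mapping.keys v \<subseteq> \<xi>}"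

fun dense_basis_act :: "complex \<Rightarrow> sl2_basis \<Rightarrow> complex \<Rightarrow> (complex \<Rightarrow>\<^sub>0 complex)" where
  "dense_basis_act \<tau> Sl_f \<mu> = basis_vec (\<mu> - 2)"
| "dense_basis_act \<tau> Sl_h \<mu> = \<mu> *\<^sub>C basis_vec \<mu>"
| "dense_basis_act \<tau> Sl_e \<mu> = ((\<tau> - (\<mu> + 1)\<^sup>2) / 4) *\<^sub>C basis_vec (\<mu> + 2)"

definition dense_act :: "complex \<Rightarrow> sl2 \<Rightarrow> (complex \<Rightarrow>\<^sub>0 complex) \<Rightarrow> (complex \<Rightarrow>\<^sub>0 complex)" where
  "dense_act \<tau> = bilin_ext (dense_basis_act \<tau>)"

lemma C_mod_2Z_shift:
  assumes "\<xi> \<in> C_mod_2Z" "\<mu> \<in> \<xi>"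
  shows "\<mu> + 2 * of_int k \<in> \<xi>"
proof -
  obtain a where xi: "\<xi> = {b. \<exists>k :: int. a - b = 2 * of_int k}"
    using assms(1) by (auto simp: C_mod_2Z_def quotient_def)
  then obtain j :: int where "a - \<mu> = 2 * of_int j"
    using assms(2) by auto
  then have "a - (\<mu> + 2 * of_int k) = 2 * of_int (j - k)"
    by (simp add: algebra_simps)
  then show ?thesis
    unfolding xi by blast
qed

lemma dense_lie_module:
  assumes "\<xi> \<in> C_mod_2Z"
  shows "lie_module pm_scale sl2_bracket pm_scale (dense_space \<xi>) (dense_act \<tau>)"
  unfolding sl2_bracket_def dense_space_def dense_act_def
proof (rule bilin_ext_lie_module)
  show "lie_algebra pm_scale (bilin_ext sl2_basis_bracket)"
    using sl2_lie_algebra by (simp add: sl2_bracket_def)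
next
  fix a \<mu> assume "\<mu> \<in> \<xi>"
  then show "Poly_Mapping.keys (dense_basis_act \<tau> a \<mu>) \<subseteq> \<xi>"
    using C_mod_2Z_shift[OF assms, of \<mu> 1] C_mod_2Z_shift[OF assms, of \<mu> "-1"]
    by (cases a) auto
next
  fix a a' \<mu>
  show "lin_ext (\<lambda>c. dense_basis_act \<tau> c \<mu>) (sl2_basis_bracket a a')
      = lin_ext (dense_basis_act \<tau> a) (dense_basis_act \<tau> a' \<mu>)
      - lin_ext (dense_basis_act \<tau> a') (dense_basis_act \<tau> a \<mu>)"
    by (cases a; cases a';
        simp add: single_uminus flip: single_diff;
        rule poly_mapping_eqI;
        auto simp: lookup_single when_def;
        simp add: field_simps power2_eq_square)
qed

text \<open>
  The compatible structures on \<open>V(\<xi>, \<tau>)\<close> for a Lie algebra with bracket \<open>bracket\<close> that receives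
  \<open>sl(2)\<close> through \<open>\<iota>\<close>. Extensionality fixes the irrelevant values of \<open>act\<close> outside the module, so
  that two members of this set are equal exactly if they are the same structure.
\<close>

definition compatible_structures ::
    "(('g \<Rightarrow>\<^sub>0 complex) \<Rightarrow> ('g \<Rightarrow>\<^sub>0 complex) \<Rightarrow> ('g \<Rightarrow>\<^sub>0 complex)) \<Rightarrow> (sl2 \<Rightarrow> ('g \<Rightarrow>\<^sub>0 complex)) \<Rightarrow>
     complex set \<Rightarrow> complex \<Rightarrow> (('g \<Rightarrow>\<^sub>0 complex) \<Rightarrow> (complex \<Rightarrow>\<^sub>0 complex) \<Rightarrow> (complex \<Rightarrow>\<^sub>0 complex)) set" where
  "compatible_structures bracket \<iota> \<xi> \<tau> =
     {act. lie_module pm_scale bracket pm_scale (dense_space \<xi>) act \<and>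
           (\<forall>x. act x \<in> extensional (dense_space \<xi>)) \<and>
           (\<forall>x. \<forall>v\<in>dense_space \<xi>. act (\<iota> x) v = dense_act \<tau> x v)}"

abbreviation witt_structures where
  "witt_structures \<equiv> compatible_structures witt_bracket sl2_to_witt"

abbreviation vir_structures where
  "vir_structures \<equiv> compatible_structures vir_bracket sl2_to_vir"

section \<open>The explicit structures\<close>

text \<open>
  For \<open>n \<le> -1\<close> the denominator is \<open>(z+n)(z+n+1)\<cdots>(z-1)\<close>; if it vanishes, the value is the
  meaningless \<open>1/0 = 0\<close>.
\<close>

definition P :: "complex \<Rightarrow> int \<Rightarrow> complex" where
  "P z n = (if n \<ge> 0 then pochhammer z (nat n)
            else 1 / pochhammer (z + of_int n) (nat (- n)))"

text \<open>In the following, \<open>r\<close> stands for the chosen square root \<open>\<plusminus>\<surd>\<tau>\<close>.\<close>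

definition rho_coeff :: "complex \<Rightarrow> int \<Rightarrow> complex \<Rightarrow> complex" where
  "rho_coeff r i \<mu> =
     (-1) powi i / 2 * (of_int i * (r - 1) - \<mu>) * P ((1 + \<mu> + r) / 2) i"

definition rho_witt ::
    "complex set \<Rightarrow> complex \<Rightarrow> witt \<Rightarrow> (complex \<Rightarrow>\<^sub>0 complex) \<Rightarrow> (complex \<Rightarrow>\<^sub>0 complex)" where
  "rho_witt \<xi> r x = restrict
     (bilin_ext (\<lambda>i \<mu>. rho_coeff r i \<mu> *\<^sub>C basis_vec (\<mu> + 2 * of_int i)) x) (dense_space \<xi>)"

definition rho_vir ::
    "complex set \<Rightarrow> complex \<Rightarrow> vir \<Rightarrow> (complex \<Rightarrow>\<^sub>0 complex) \<Rightarrow> (complex \<Rightarrow>\<^sub>0 complex)" where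
  "rho_vir \<xi> r x = restrict
     (bilin_ext (\<lambda>b \<mu>. case b of
        Vir_L i \<Rightarrow> rho_coeff r i \<mu> *\<^sub>C basis_vec (\<mu> + 2 * of_int i)
      | Vir_C \<Rightarrow> 0) x) (dense_space \<xi>)"

end

theory Submission
  imports Defs
begin

text \<open>
  Write \<open>r\<close> for a square root of \<open>\<tau>\<close> and let \<open>z = (1 + \<mu> + r) / 2\<close>. Since \<open>P z i = \<Gamma>(z + i) / \<Gamma>(z)\<close>, the
  vectors \<open>w\<^sub>\<mu> = \<plusminus>\<Gamma>(z) v\<^sub>\<mu>\<close>, with signs that alternate along \<open>\<xi>\<close>, satisfy
  \<open>L\<^sub>i w\<^sub>\<mu> = (i (r - 1) - \<mu>) / 2 \<cdot> w\<^bsub>\<mu>+2i\<^esub>\<close>, the classical action of vector fields on tensor densities. Hence \<open>\<rho>\<close> is a representation as soon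
  as no factor of a Pochhammer symbol is zero. As \<open>\<mu>\<close> runs through \<open>\<xi>\<close> this says that \<open>z\<close> is never an
  integer, that is \<open>1 - r \<notin> \<xi>\<close>. (The proof uses the cocycle identity \<open>P_add\<close>
  instead of the Gamma function.)

  Conversely, a structure for the Virasoro algebra preserves weights, so it is given by coefficients
  \<open>L\<^sub>i v\<^sub>\<mu> = c\<^sub>i(\<mu>) v\<^bsub>\<mu>+2i\<^esub>\<close>, of which \<open>c\<^bsub>-1\<^esub>\<close>, \<open>c\<^sub>0\<close> and \<open>c\<^sub>1\<close> are prescribed. The bracket
  \<open>[L\<^sub>2, L\<^bsub>-1\<^esub>] = 3 L\<^sub>1\<close> determines \<open>c\<^sub>2\<close> up to one constant, and the relation \<open>[L\<^sub>4, L\<^sub>1] = 3 [L\<^sub>3, L\<^sub>2]\<close>,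
  written in terms of \<open>L\<^sub>1\<close> and \<open>L\<^sub>2\<close>, is a quadratic equation for this constant. Its two roots belong
  to \<open>\<rho>\<close> for the two signs of the square root. So \<open>c\<^sub>2\<close> is always the coefficient of \<open>\<rho>\<close> for one of the
  two values of \<open>r\<close> (\<open>c_2_cases\<close>).

  If \<open>1 - r \<in> \<xi>\<close> for this value of \<open>r\<close>, then \<open>c\<^sub>1\<close> vanishes at \<open>-1 - r \<in> \<xi>\<close>. The recursion that
  \<open>[L\<^bsub>-2\<^esub>, L\<^sub>1] = -3 L\<^bsub>-1\<^esub>\<close> imposes on \<open>c\<^bsub>-2\<^esub>\<close> breaks there and fixes \<open>c\<^bsub>-2\<^esub>\<close> on both sides of this weight;
  the bracket \<open>[L\<^sub>2, L\<^bsub>-2\<^esub>] = 4 L\<^sub>0 + C / 2\<close> is then violated, whatever the value of \<open>C\<close>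
  (\<open>c_2_imp_root_notin\<close>). This gives the nonexistence when both roots lie in \<open>\<xi>\<close>. If the dense module
  is simple, \<open>c\<^sub>1\<close> has no zero, and \<open>c\<^sub>2\<close> then determines \<open>c\<^bsub>-2\<^esub>\<close> and everything else
  (\<open>weight_coefficients_unique\<close>), so the structures are exactly \<open>\<rho>\<close> for the two signs. They coincide
  if and only if their \<open>c\<^sub>2\<close> do, and these differ by \<open>r (\<tau> - 1) / 2\<close>.

  A Witt structure is a Virasoro structure through the quotient by \<open>C\<close>, so the classification is needed
  only for the Virasoro algebra and the construction only for the Witt algebra.
\<close>

(* Both int and complex serve as basis indices and have a zero, so these rules would rewrite the
   basis vector with index 0 to the unit of the ring of finitely supported functions. *)
declare single_one [simp del] single_numeral [simp del]

section \<open>Lie modules\<close>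

lemma lie_module_cong:
  assumes "lie_module scale bracket mscale V act" and eq: "\<And>x v. v \<in> V \<Longrightarrow> act' x v = act x v"
  shows "lie_module scale bracket mscale V act'"
proof -
  interpret lie_module scale bracket mscale V act by fact
  show ?thesis
    by unfold_locales
      (simp_all add: eq subspace act_closed M.subspace_add[OF subspace] M.subspace_scale[OF subspace]
        act_add act_scale act_add_left act_scale_left act_bracket)
qed

lemma lie_module_pullback:
  assumes "lie_module scale bracket mscale V act" "lie_algebra scale' bracket'"
    and "\<And>x y. \<phi> (x + y) = \<phi> x + \<phi> y" "\<And>k x. \<phi> (scale' k x) = scale k (\<phi> x)"
    and "\<And>x y. \<phi> (bracket' x y) = bracket (\<phi> x) (\<phi> y)"
  shows "lie_module scale' bracket' mscale V (\<lambda>x. act (\<phi> x))"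
proof -
  interpret lie_module scale bracket mscale V act by fact
  interpret L: lie_algebra scale' bracket' by fact
  show ?thesis
    by unfold_locales
      (simp_all add: assms subspace act_closed
        act_add act_scale act_add_left act_scale_left act_bracket)
qed

lemma lie_module_submodule:
  assumes "lie_module scale bracket mscale V act" and "W \<subseteq> V" "module.subspace mscale W"
    and "\<And>x v. v \<in> W \<Longrightarrow> act x v \<in> W"
  shows "lie_module scale bracket mscale W act"
proof -
  interpret lie_module scale bracket mscale V act by fact
  show ?thesis
    using assms(2-4)
    by unfold_locales
      (simp_all add: subset_iff
        act_add act_scale act_add_left act_scale_left act_bracket)
qed

lemma supported_subspace: "pm.subspace {v :: 'b \<Rightarrow>\<^sub>0 complex. Poly_Mapping.keys v \<subseteq> S}"
  by (rule pm.subspaceI) (auto dest: subsetD[OF keys_add] simp: in_keys_iff)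

lemma bilin_ext_keys:
  assumes "\<And>a b. b \<in> S \<Longrightarrow> Poly_Mapping.keys (n a b) \<subseteq> S" "Poly_Mapping.keys v \<subseteq> S"
  shows "Poly_Mapping.keys (bilin_ext n x v) \<subseteq> S"
proof (induction x rule: pm_induct)
  case (single a c)
  show ?case
  proof (induction v rule: pm_induct)
    case (single b d)
    then have "Poly_Mapping.keys (n a b) \<subseteq> S" using assms by auto
    then show ?case by (auto simp: in_keys_iff)
  qed (use keys_add in \<open>fastforce simp: bilin_ext_linear\<close>)+
qed (use keys_add in \<open>fastforce simp: bilin_ext_linear\<close>)+

lemma C_mod_2Z_diff:
  assumes "\<xi> \<in> C_mod_2Z" "\<mu> \<in> \<xi>" "\<nu> \<in> \<xi>"
  obtains k :: int where "\<nu> = \<mu> + 2 * of_int k"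
proof -
  obtain a where xi: "\<xi> = {b. \<exists>k :: int. a - b = 2 * of_int k}"
    using assms(1) by (auto simp: C_mod_2Z_def quotient_def)
  then obtain i j :: int where "a - \<mu> = 2 * of_int i" "a - \<nu> = 2 * of_int j"
    using assms by auto
  then have "\<nu> = \<mu> + 2 * of_int (i - j)"
    by (simp add: algebra_simps)
  then show thesis ..
qed

lemma C_mod_2Z_nonempty:
  assumes "\<xi> \<in> C_mod_2Z"
  shows "\<xi> \<noteq> {}"
proof -
  obtain a where "\<xi> = {b. \<exists>k :: int. a - b = 2 * of_int k}"
    using assms by (auto simp: C_mod_2Z_def quotient_def)
  moreover have "a - a = 2 * of_int 0"
    by simp
  ultimately show ?thesis
    by blast
qed

section \<open>Witt structures as Virasoro structures\<close>

definition vir_to_witt :: "vir \<Rightarrow> witt" where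
  "vir_to_witt = lin_ext (\<lambda>b. case b of Vir_L i \<Rightarrow> basis_vec i | Vir_C \<Rightarrow> 0)"

text \<open>
  A linear section of the quotient map. It is not a homomorphism of Lie algebras; it serves to show that
  the quotient map is surjective.
\<close>

definition witt_to_vir :: "witt \<Rightarrow> vir" where
  "witt_to_vir = lin_ext (\<lambda>i. basis_vec (Vir_L i))"

lemma vir_to_witt_hom: "vir_to_witt (vir_bracket x y) = witt_bracket (vir_to_witt x) (vir_to_witt y)"
  unfolding vir_to_witt_def vir_bracket_def witt_bracket_def
proof (rule lin_ext_hom)
  fix a b
  show "lin_ext (case_vir_basis basis_vec 0) (vir_basis_bracket a b)
      = bilin_ext (\<lambda>i j. of_int (i - j) *\<^sub>C basis_vec (i + j))
         (case a of Vir_L x \<Rightarrow> basis_vec x | Vir_C \<Rightarrow> 0) (case b of Vir_L x \<Rightarrow> basis_vec x | Vir_C \<Rightarrow> 0)"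
    by (cases a; cases b) (auto simp: lin_ext_add)
qed

lemma vir_to_witt_sl2: "vir_to_witt (sl2_to_vir x) = sl2_to_witt x"
proof (induction x rule: pm_induct)
  case (single k a)
  then show ?case
    by (cases k) (simp_all add: vir_to_witt_def sl2_to_vir_def sl2_to_witt_def single_uminus)
qed (simp_all add: vir_to_witt_def sl2_to_vir_def sl2_to_witt_def lin_ext_add)

lemma vir_to_witt_to_vir: "vir_to_witt (witt_to_vir x) = x"
  by (induction x rule: pm_induct) (simp_all add: vir_to_witt_def witt_to_vir_def lin_ext_add)

lemma witt_structures_pullback:
  assumes "act \<in> witt_structures \<xi> \<tau>"
  shows "(\<lambda>x. act (vir_to_witt x)) \<in> vir_structures \<xi> \<tau>"
  using assms
  by (auto simp: compatible_structures_def vir_to_witt_sl2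
      intro!: lie_module_pullback[OF _ vir_lie_algebra] vir_to_witt_hom)
    (simp_all add: vir_to_witt_def lin_ext_add lin_ext_scale)

lemma pullback_inject:
  "(\<lambda>x. act (vir_to_witt x)) = (\<lambda>x. act' (vir_to_witt x)) \<longleftrightarrow> act = act'"
proof
  assume eq: "(\<lambda>x. act (vir_to_witt x)) = (\<lambda>x. act' (vir_to_witt x))"
  show "act = act'"
  proof
    show "act x = act' x" for x
      using fun_cong[OF eq, of "witt_to_vir x"] by (simp only: vir_to_witt_to_vir)
  qed
qed simp

lemma rho_vir_pullback: "rho_vir \<xi> r = (\<lambda>x. rho_witt \<xi> r (vir_to_witt x))"
proof -
  have "bilin_ext (\<lambda>b \<mu>. case b of
        Vir_L i \<Rightarrow> rho_coeff r i \<mu> *\<^sub>C basis_vec (\<mu> + 2 * of_int i)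
      | Vir_C \<Rightarrow> 0) x v
    = bilin_ext (\<lambda>i \<mu>. rho_coeff r i \<mu> *\<^sub>C basis_vec (\<mu> + 2 * of_int i)) (vir_to_witt x) v" for x v
  proof (induction x rule: pm_induct)
    case (single k a)
    show ?case
      by (cases k) (simp_all add: vir_to_witt_def bilin_ext_def)
  qed (simp_all add: bilin_ext_linear vir_to_witt_def lin_ext_add)
  then have "rho_vir \<xi> r x v = rho_witt \<xi> r (vir_to_witt x) v" for x v
    by (simp only: rho_vir_def rho_witt_def restrict_def)
  then show ?thesis
    by blast
qed

section \<open>The structures given by Pochhammer symbols\<close>

lemma P_Suc:
  assumes "z \<notin> \<int>"
  shows "P z (n + 1) = P z n * (z + of_int n)"
proof (cases "n \<ge> 0")
  case True
  then obtain m where n: "n = int m" by (metis nonneg_int_cases)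
  then show ?thesis by (simp add: P_def nat_add_distrib pochhammer_Suc)
next
  case False
  then obtain m where n: "n = - 1 - int m"
    by (intro that[of "nat (- 1 - n)"]) simp
  have "z + of_int n \<noteq> 0"
    using assms by (metis Ints_minus Ints_of_int eq_neg_iff_add_eq_0)
  then show ?thesis
    by (simp add: n P_def nat_diff_distrib nat_add_distrib pochhammer_rec)
qed

text \<open>
  With \<open>P z i = \<Gamma>(z + i) / \<Gamma>(z)\<close> the quotients telescope. For negative indices the recursion is a division
  by \<open>z + i\<close>, which is why \<open>z\<close> must not be an integer.
\<close>

lemma P_add:
  assumes "z \<notin> \<int>"
  shows "P z (i + j) = P z i * P (z + of_int i) j"
proof (induction j rule: int_induct[where k = 0])
  case base
  then show ?case by (simp add: P_def)
next
  case (step1 j)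
  have "z + of_int i \<notin> \<int>" using assms by simp
  then show ?case
    using P_Suc[OF assms, of "i + j"] P_Suc[of "z + of_int i" j] step1
    by (simp add: add.assoc)
next
  case (step2 j)
  have z: "z + of_int i \<notin> \<int>" using assms by simp
  moreover have "z + of_int i + (of_int j - 1) \<noteq> 0"
    using z by (metis Ints_minus Ints_of_int eq_neg_iff_add_eq_0 of_int_1 of_int_diff)
  ultimately show ?case
    using P_Suc[OF assms, of "i + (j - 1)"] P_Suc[of "z + of_int i" "j - 1"] step2
    by (simp add: add.assoc)
qed

text \<open>
  In both products the Pochhammer symbols combine to \<open>P z (i + j)\<close> by \<open>P_add\<close>. What remains is the bracket
  of vector fields acting on tensor densities, an identity between quadratic polynomials.
\<close>

lemma rho_coeff_bracket:
  assumes "(1 + \<mu> + r) / 2 \<notin> \<int>"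
  shows "rho_coeff r j \<mu> * rho_coeff r i (\<mu> + 2 * of_int j)
       - rho_coeff r i \<mu> * rho_coeff r j (\<mu> + 2 * of_int i)
       = of_int (i - j) * rho_coeff r (i + j) \<mu>"
proof -
  define z where "z = (1 + \<mu> + r) / 2"
  have z': "(1 + (\<mu> + 2 * of_int k) + r) / 2 = z + of_int k" for k
    by (simp add: z_def field_simps)
  have P: "P z i * P (z + of_int i) j = P z (i + j)" for i j
    using assms P_add[of z i j] by (simp add: z_def)
  have prod: "rho_coeff r j \<mu> * rho_coeff r i (\<mu> + 2 * of_int j)
      = (-1) powi (i + j) / 4 * (of_int j * (r - 1) - \<mu>) * (of_int i * (r - 1) - (\<mu> + 2 * of_int j))
        * P z (i + j)" for i j
    unfolding rho_coeff_def z' z_def[symmetric] P[of j i, symmetric] add.commute[of i j]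
    by (simp add: power_int_add mult_ac)
  have sum: "rho_coeff r (i + j) \<mu> = (-1) powi (i + j) / 2 * (of_int (i + j) * (r - 1) - \<mu>) * P z (i + j)"
    by (simp add: rho_coeff_def z_def)
  show ?thesis
    unfolding sum prod add.commute[of j i] by (simp add: field_simps)
qed

text \<open>
  These are the coefficients of \<open>- e\<close>, \<open>- h / 2\<close> and \<open>f\<close> on the dense module. The exceptional weight
  \<open>1 - r\<close> in the third line is where \<open>P z (-1)\<close> divides by zero.
\<close>

lemma rho_coeff_sl2:
  assumes "r\<^sup>2 = \<tau>"
  shows "rho_coeff r 1 \<mu> = - ((\<tau> - (\<mu> + 1)\<^sup>2) / 4)" "rho_coeff r 0 \<mu> = - \<mu> / 2"
    "\<mu> \<noteq> 1 - r \<Longrightarrow> rho_coeff r (-1) \<mu> = 1"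
proof -
  have "rho_coeff r 1 \<mu> = - 1 / 2 * (r - 1 - \<mu>) * ((1 + \<mu> + r) / 2)"
    by (simp add: rho_coeff_def P_def)
  also have "\<dots> = - ((r\<^sup>2 - (\<mu> + 1)\<^sup>2) / 4)"
    by (simp add: field_simps power2_eq_square)
  finally show "rho_coeff r 1 \<mu> = - ((\<tau> - (\<mu> + 1)\<^sup>2) / 4)"
    by (simp only: assms)
  show "rho_coeff r 0 \<mu> = - \<mu> / 2"
    by (simp add: rho_coeff_def P_def)
  assume "\<mu> \<noteq> 1 - r"
  then have nz: "\<mu> + r - 1 \<noteq> 0"
    by (simp add: eq_diff_eq)
  have "P ((1 + \<mu> + r) / 2) (-1) = 1 / ((1 + \<mu> + r) / 2 - 1)"
    by (simp add: P_def)
  also have "(1 + \<mu> + r) / 2 - 1 = (\<mu> + r - 1) / 2"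
    by (simp add: diff_divide_distrib add_divide_distrib)
  finally have P: "P ((1 + \<mu> + r) / 2) (-1) = 2 / (\<mu> + r - 1)"
    by simp
  have lin: "of_int (- 1) * (r - 1) - \<mu> = - (\<mu> + r - 1)"
    by simp
  have "(-1) powi (-1) / 2 * (- w) * (2 / w) = 1" if "w \<noteq> 0" for w :: complex
    using that by simp
  then show "rho_coeff r (-1) \<mu> = 1"
    unfolding rho_coeff_def P lin using nz by blast
qed

lemma rho_coeff_2:
  "rho_coeff r 2 \<mu> = (2 * (r - 1) - \<mu>) * (1 + \<mu> + r) * (3 + \<mu> + r) / 8"
proof -
  have "P z 2 = z * (z + 1)" for z
    by (simp add: P_def pochhammer_Suc numeral_2_eq_2)
  then have "rho_coeff r 2 \<mu>
      = 1 / 2 * (2 * (r - 1) - \<mu>) * ((1 + \<mu> + r) / 2 * ((1 + \<mu> + r) / 2 + 1))"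
    by (simp add: rho_coeff_def)
  also have "(1 + \<mu> + r) / 2 + 1 = (3 + \<mu> + r) / 2"
    by (simp add: field_simps)
  finally show ?thesis
    by simp
qed

lemma rho_witt_structure:
  assumes coset: "\<xi> \<in> C_mod_2Z" and r: "r\<^sup>2 = \<tau>" and root: "1 - r \<notin> \<xi>"
  shows "rho_witt \<xi> r \<in> witt_structures \<xi> \<tau>"
proof -
  let ?n = "\<lambda>i \<mu>. rho_coeff r i \<mu> *\<^sub>C basis_vec (\<mu> + 2 * of_int i)"
  (* Integer values of z = (1 + \<mu> + r) / 2 occur exactly for the weights in the class of 1 - r. *)
  have nonint: "(1 + \<mu> + r) / 2 \<notin> \<int>" if "\<mu> \<in> \<xi>" for \<mu>
  proof
    assume "(1 + \<mu> + r) / 2 \<in> \<int>"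
    then obtain k where "(1 + \<mu> + r) / 2 = of_int k" by (elim Ints_cases)
    then have "1 - r = \<mu> + 2 * of_int (1 - k)" by (simp add: field_simps)
    then have "1 - r \<in> \<xi>" by (simp only: C_mod_2Z_shift[OF coset that])
    then show False using root by simp
  qed
  have "lie_module pm_scale witt_bracket pm_scale (dense_space \<xi>) (bilin_ext ?n)"
    unfolding witt_bracket_def dense_space_def
  proof (rule bilin_ext_lie_module)
    show "lie_algebra pm_scale (bilin_ext (\<lambda>i j. of_int (i - j) *\<^sub>C basis_vec (i + j)))"
      using witt_lie_algebra by (simp add: witt_bracket_def)
  next
    fix i \<mu> assume "\<mu> \<in> \<xi>"
    then show "Poly_Mapping.keys (?n i \<mu>) \<subseteq> \<xi>"
      using C_mod_2Z_shift[OF coset, of \<mu> i] by auto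
  next
    fix i j \<mu> assume mu: "\<mu> \<in> \<xi>"
    have idx: "\<mu> + 2 * of_int j + 2 * of_int i = \<mu> + 2 * of_int (i + j)" for i j
      by (simp add: algebra_simps)
    have comp: "lin_ext (?n i) (?n j \<mu>) = Poly_Mapping.single (\<mu> + 2 * of_int (i + j))
        (rho_coeff r j \<mu> * rho_coeff r i (\<mu> + 2 * of_int j))" for i j
      by (simp only: pm_scale_simps lin_ext_single mult_1_right idx)
    show "lin_ext (\<lambda>c. ?n c \<mu>) (of_int (i - j) *\<^sub>C basis_vec (i + j))
        = lin_ext (?n i) (?n j \<mu>) - lin_ext (?n j) (?n i \<mu>)"
      unfolding comp add.commute[of j i] single_diff[symmetric]
        rho_coeff_bracket[OF nonint[OF mu]]
      by (simp only: pm_scale_simps lin_ext_single mult_1_right)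
  qed
  then have mod: "lie_module pm_scale witt_bracket pm_scale (dense_space \<xi>) (rho_witt \<xi> r)"
    by (rule lie_module_cong) (simp add: rho_witt_def)
  have "bilin_ext ?n (sl2_to_witt x) v = dense_act \<tau> x v" if "v \<in> dense_space \<xi>" for x v
  proof (induction x rule: pm_induct)
    case (single k a)
    show ?case
    proof (induction v rule: pm_induct)
      case (single \<mu> d)
      then have mu: "\<mu> \<in> \<xi>" using that by (auto simp: dense_space_def)
      have "\<mu> \<noteq> 1 - r"
        using mu root by auto
      then show ?case
        by (cases k)
          (simp_all add: sl2_to_witt_def dense_act_def single_uminus rho_coeff_sl2[OF r] mult.assoc)
    qed (simp_all add: bilin_ext_linear dense_act_def)
  qed (simp_all add: bilin_ext_linear sl2_to_witt_def dense_act_def lin_ext_add)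
  then have "\<forall>x. \<forall>v\<in>dense_space \<xi>. rho_witt \<xi> r (sl2_to_witt x) v = dense_act \<tau> x v"
    by (simp add: rho_witt_def)
  moreover have "rho_witt \<xi> r x \<in> extensional (dense_space \<xi>)" for x
    by (simp add: rho_witt_def)
  ultimately show ?thesis
    unfolding compatible_structures_def using mod by blast
qed

section \<open>The relations between the coefficients of a structure\<close>

text \<open>
  The relations satisfied by the coefficients in \<open>L\<^sub>i v\<^sub>\<mu> = c\<^sub>i(\<mu>) v\<^bsub>\<mu>+2i\<^esub>\<close> and \<open>C v\<^sub>\<mu> = \<gamma>(\<mu>) v\<^sub>\<mu>\<close> when a Virasoro
  structure restricts to the given \<open>sl(2)\<close>-structure.
\<close>

locale weight_coefficients =
  fixes \<xi> :: "complex set" and \<tau> :: complex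
    and c :: "int \<Rightarrow> complex \<Rightarrow> complex" and \<gamma> :: "complex \<Rightarrow> complex"
  assumes coset: "\<xi> \<in> C_mod_2Z"
    and c_neg1: "\<mu> \<in> \<xi> \<Longrightarrow> c (-1) \<mu> = 1"
    and c_0: "\<mu> \<in> \<xi> \<Longrightarrow> c 0 \<mu> = - \<mu> / 2"
    and c_1: "\<mu> \<in> \<xi> \<Longrightarrow> c 1 \<mu> = ((\<mu> + 1)\<^sup>2 - \<tau>) / 4"
    and c_bracket: "\<mu> \<in> \<xi> \<Longrightarrow>
      c j \<mu> * c i (\<mu> + 2 * of_int j) - c i \<mu> * c j (\<mu> + 2 * of_int i)
        = of_int (i - j) * c (i + j) \<mu>
          + (if i + j = 0 then of_int (i ^ 3 - i) / 12 * \<gamma> \<mu> else 0)"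
    and \<gamma>_shift: "\<mu> \<in> \<xi> \<Longrightarrow> \<gamma> (\<mu> + 2) = \<gamma> \<mu>"
begin

lemma shift_mem: "\<mu> \<in> \<xi> \<Longrightarrow> \<mu> + 2 * of_int k \<in> \<xi>"
  using C_mod_2Z_shift[OF coset] .

lemma shift_mem_numeral:
  assumes "\<mu> \<in> \<xi>"
  shows "\<mu> + 2 \<in> \<xi>" "\<mu> + 4 \<in> \<xi>" "\<mu> + 6 \<in> \<xi>" "\<mu> + 8 \<in> \<xi>"
    "\<mu> - 2 \<in> \<xi>" "\<mu> - 4 \<in> \<xi>" "\<mu> - 6 \<in> \<xi>"
  using shift_mem[OF assms, of 1] shift_mem[OF assms, of 2] shift_mem[OF assms, of 3]
    shift_mem[OF assms, of 4] shift_mem[OF assms, of "-1"] shift_mem[OF assms, of "-2"]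
    shift_mem[OF assms, of "-3"]
  by simp_all

lemma c_2_shift:
  assumes "\<mu> \<in> \<xi>" shows "c 2 (\<mu> + 2) = c 2 \<mu> - 3 * c 1 (\<mu> + 2)"
  using c_bracket[of "\<mu> + 2" "-1" 2] shift_mem_numeral[OF assms]
  by (simp add: c_neg1 add.assoc algebra_simps)

lemma c_3:
  assumes "\<mu> \<in> \<xi>" shows "c 3 \<mu> = c 1 \<mu> * c 2 (\<mu> + 2) - c 2 \<mu> * c 1 (\<mu> + 4)"
  using c_bracket[OF assms, of 1 2] by simp

lemma c_neg2_shift:
  assumes "\<mu> \<in> \<xi>"
  shows "c (-2) \<mu> * c 1 (\<mu> - 4) - c 1 \<mu> * c (-2) (\<mu> + 2) = 3"
  using c_bracket[OF assms, of "-2" 1] by (simp add: c_neg1[OF assms])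

lemma c_neg2_c_3:
  assumes "\<mu> \<in> \<xi>"
  shows "c (-2) \<mu> * c 3 (\<mu> - 4) - c 3 \<mu> * c (-2) (\<mu> + 6) = 5 * c 1 \<mu>"
  using c_bracket[OF assms, of "-2" 3] by simp

text \<open>
  By the brackets with \<open>L\<^sub>1\<close>, the operators \<open>L\<^sub>3\<close>, \<open>L\<^sub>4\<close>, \<open>L\<^sub>5\<close> are polynomials in \<open>L\<^sub>1\<close> and \<open>L\<^sub>2\<close>. Two
  expressions for \<open>L\<^sub>5\<close> result, from \<open>[L\<^sub>4, L\<^sub>1]\<close> and from \<open>[L\<^sub>3, L\<^sub>2]\<close>. Applied to \<open>v\<^sub>\<mu>\<close>, with all values of
  \<open>c\<^sub>2\<close> expressed by \<open>c\<^sub>2(\<mu>)\<close>, they give a quadratic equation for \<open>c\<^sub>2(\<mu>)\<close>. Both formulas for \<open>\<rho>\<close> satisfy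
  it, so its roots are known.
\<close>

lemma c_2_factor:
  assumes mu: "\<mu> \<in> \<xi>" and s: "s\<^sup>2 = \<tau>"
  shows "(c 2 \<mu> - rho_coeff s 2 \<mu>) * (c 2 \<mu> - rho_coeff (- s) 2 \<mu>) = 0"
proof -
  note mem = shift_mem_numeral[OF mu]
  have c4: "2 * c 4 \<nu> = c 1 \<nu> * c 3 (\<nu> + 2) - c 3 \<nu> * c 1 (\<nu> + 6)" if "\<nu> \<in> \<xi>" for \<nu>
    using c_bracket[OF that, of 1 3] by simp
  have c5: "3 * c 5 \<mu> = c 1 \<mu> * c 4 (\<mu> + 2) - c 4 \<mu> * c 1 (\<mu> + 8)"
    using c_bracket[OF mu, of 1 4] by simp
  have c5': "c 5 \<mu> = c 2 \<mu> * c 3 (\<mu> + 4) - c 3 \<mu> * c 2 (\<mu> + 6)"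
    using c_bracket[OF mu, of 2 3] by simp
  have "6 * (c 2 \<mu> * c 3 (\<mu> + 4) - c 3 \<mu> * c 2 (\<mu> + 6))
      = c 1 \<mu> * (2 * c 4 (\<mu> + 2)) - (2 * c 4 \<mu>) * c 1 (\<mu> + 8)"
    using c5 unfolding c5' by algebra
  then have rel: "6 * (c 2 \<mu> * c 3 (\<mu> + 4) - c 3 \<mu> * c 2 (\<mu> + 6))
      = c 1 \<mu> * (c 1 (\<mu> + 2) * c 3 (\<mu> + 4) - c 3 (\<mu> + 2) * c 1 (\<mu> + 8))
        - (c 1 \<mu> * c 3 (\<mu> + 2) - c 3 \<mu> * c 1 (\<mu> + 6)) * c 1 (\<mu> + 8)"
    using mem by (simp add: c4 mu add.assoc)
  define x where "x = c 2 \<mu>"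
  have c1: "c 1 \<mu> = ((\<mu> + 1)\<^sup>2 - s\<^sup>2) / 4" "c 1 (\<mu> + 2) = ((\<mu> + 3)\<^sup>2 - s\<^sup>2) / 4"
    "c 1 (\<mu> + 4) = ((\<mu> + 5)\<^sup>2 - s\<^sup>2) / 4" "c 1 (\<mu> + 6) = ((\<mu> + 7)\<^sup>2 - s\<^sup>2) / 4"
    "c 1 (\<mu> + 8) = ((\<mu> + 9)\<^sup>2 - s\<^sup>2) / 4"
    using mem mu by (simp_all add: c_1 s add.assoc)
  have c2: "c 2 (\<mu> + 2) = x - 3 * c 1 (\<mu> + 2)"
    "c 2 (\<mu> + 4) = x - 3 * c 1 (\<mu> + 2) - 3 * c 1 (\<mu> + 4)"
    "c 2 (\<mu> + 6) = x - 3 * c 1 (\<mu> + 2) - 3 * c 1 (\<mu> + 4) - 3 * c 1 (\<mu> + 6)"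
    using c_2_shift[OF mu] c_2_shift[OF mem(1)] c_2_shift[OF mem(2)]
    by (simp_all add: x_def add.assoc)
  have c3: "c 3 \<mu> = c 1 \<mu> * c 2 (\<mu> + 2) - x * c 1 (\<mu> + 4)"
    "c 3 (\<mu> + 2) = c 1 (\<mu> + 2) * c 2 (\<mu> + 4) - c 2 (\<mu> + 2) * c 1 (\<mu> + 6)"
    "c 3 (\<mu> + 4) = c 1 (\<mu> + 4) * c 2 (\<mu> + 6) - c 2 (\<mu> + 4) * c 1 (\<mu> + 8)"
    using c_3[OF mu] c_3[OF mem(1)] c_3[OF mem(2)] by (simp_all add: x_def add.assoc)
  (* The factor -48 is the coefficient of x squared in the relation. *)
  have "- 48 * ((c 2 \<mu> - rho_coeff s 2 \<mu>) * (c 2 \<mu> - rho_coeff (- s) 2 \<mu>))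
     = 6 * (x * c 3 (\<mu> + 4) - c 3 \<mu> * c 2 (\<mu> + 6))
       - (c 1 \<mu> * (c 1 (\<mu> + 2) * c 3 (\<mu> + 4) - c 3 (\<mu> + 2) * c 1 (\<mu> + 8))
        - (c 1 \<mu> * c 3 (\<mu> + 2) - c 3 \<mu> * c 1 (\<mu> + 6)) * c 1 (\<mu> + 8))"
    unfolding rho_coeff_2 c3 c2 c1 x_def[symmetric] by (simp add: field_simps) algebra
  then show ?thesis
    using rel by (simp add: x_def)
qed

lemma shift_induct [consumes 2, case_names base up down]:
  assumes "\<mu> \<in> \<xi>" "\<nu> \<in> \<xi>" and base: "Q \<mu>"
    and up: "\<And>\<kappa>. \<kappa> \<in> \<xi> \<Longrightarrow> Q \<kappa> \<Longrightarrow> Q (\<kappa> + 2)"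
    and down: "\<And>\<kappa>. \<kappa> \<in> \<xi> \<Longrightarrow> Q (\<kappa> + 2) \<Longrightarrow> Q \<kappa>"
  shows "Q \<nu>"
proof -
  obtain k :: int where k: "\<nu> = \<mu> + 2 * of_int k"
    using C_mod_2Z_diff coset assms(1,2) .
  have "Q (\<mu> + 2 * of_int k)"
  proof (induction k rule: int_induct[where k = 0])
    case base
    then show ?case using \<open>Q \<mu>\<close> by simp
  next
    case (step1 i)
    then show ?case using up[OF shift_mem[OF assms(1), of i]] by (simp add: algebra_simps)
  next
    case (step2 i)
    then show ?case
      using down[OF shift_mem[OF assms(1), of "i - 1"]] by (simp add: algebra_simps)
  qed
  then show ?thesis by (simp add: k)
qed

text \<open>
  The formulas for \<open>\<rho>\<close> satisfy the same recursion as \<open>c\<^sub>2\<close>, so the choice of \<open>r\<close> made at one weight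
  is valid on all of \<open>\<xi>\<close>.
\<close>

lemma c_2_cases:
  assumes s: "s\<^sup>2 = \<tau>"
  obtains r where "r \<in> {s, - s}" "\<And>\<mu>. \<mu> \<in> \<xi> \<Longrightarrow> c 2 \<mu> = rho_coeff r 2 \<mu>"
proof -
  obtain \<mu> where mu: "\<mu> \<in> \<xi>"
    using C_mod_2Z_nonempty[OF coset] by blast
  have "c 2 \<mu> = rho_coeff s 2 \<mu> \<or> c 2 \<mu> = rho_coeff (- s) 2 \<mu>"
    using c_2_factor[OF mu s] by auto
  then obtain r where r: "r \<in> {s, - s}" "c 2 \<mu> = rho_coeff r 2 \<mu>"
    by blast
  have r2: "r\<^sup>2 = \<tau>" using r s by auto
  have rho_shift: "rho_coeff r 2 (\<kappa> + 2) = rho_coeff r 2 \<kappa> - 3 * c 1 (\<kappa> + 2)" if "\<kappa> \<in> \<xi>" for \<kappa>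
    unfolding c_1[OF shift_mem_numeral(1)[OF that]] r2[symmetric] rho_coeff_2
    by (simp add: field_simps power2_eq_square)
  have "c 2 \<nu> = rho_coeff r 2 \<nu>" if "\<nu> \<in> \<xi>" for \<nu>
    using mu that
    by (induction rule: shift_induct) (simp_all add: r c_2_shift rho_shift)
  then show thesis using that r by blast
qed

text \<open>
  Let \<open>\<kappa> = -1 - r\<close>. Then \<open>c\<^sub>1(\<kappa>) = 0\<close> and \<open>c\<^sub>2(\<kappa>) = c\<^sub>2(\<kappa> - 2) = 0\<close>. The relation for \<open>[L\<^bsub>-2\<^esub>, L\<^sub>1]\<close> links
  the values of \<open>c\<^bsub>-2\<^esub>\<close> at neighbouring weights with coefficients from \<open>c\<^sub>1\<close>; since \<open>c\<^sub>1(\<kappa>) = 0\<close>, it gives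
  \<open>c\<^bsub>-2\<^esub>\<close> at \<open>\<kappa>\<close> and \<open>\<kappa> - 2\<close>, and at \<open>\<kappa> + 6\<close> and \<open>\<kappa> + 8\<close>, without a free parameter. The relation for
  \<open>[L\<^sub>2, L\<^bsub>-2\<^esub>]\<close> at \<open>\<kappa>\<close>, \<open>\<kappa> - 2\<close> and \<open>\<kappa> + 4\<close> involves only these values and the central charge.
  Elimination of all unknowns leaves two polynomial equations in \<open>r\<close> without a common root.
\<close>

lemma c_2_imp_root_notin:
  assumes r: "r\<^sup>2 = \<tau>" and c2: "\<And>\<mu>. \<mu> \<in> \<xi> \<Longrightarrow> c 2 \<mu> = rho_coeff r 2 \<mu>"
  shows "1 - r \<notin> \<xi>"
proof
  assume root: "1 - r \<in> \<xi>"
  define \<kappa> where "\<kappa> = - 1 - r"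
  have mem: "\<kappa> \<in> \<xi>"
    using shift_mem_numeral(5)[OF root] by (simp add: \<kappa>_def algebra_simps)
  note mems = mem shift_mem_numeral[OF mem]
  define g where "g = \<gamma> \<kappa> / 2"
  have g: "\<gamma> \<kappa> = 2 * g" "\<gamma> (\<kappa> - 2) = 2 * g" "\<gamma> (\<kappa> + 4) = 2 * g"
    using \<gamma>_shift[OF mem] \<gamma>_shift[OF mems(6)] \<gamma>_shift[OF mems(2)] by (simp_all add: g_def add.assoc)
  have L2: "c (-2) \<mu> * c 2 (\<mu> - 4) - c 2 \<mu> * c (-2) (\<mu> + 4) = \<gamma> \<mu> / 2 - 2 * \<mu>" if "\<mu> \<in> \<xi>" for \<mu>
    using c_bracket[OF that, of "-2" 2] by (simp add: c_0[OF that])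
  have c1: "c 1 (\<kappa> + 2 * of_int k) = of_int k * (of_int k - r)" for k
    unfolding c_1[OF shift_mem[OF mem, of k]] r[symmetric]
    by (simp add: \<kappa>_def field_simps power2_eq_square)
  have c2: "c 2 (\<kappa> + 2 * of_int k)
    = of_int k * (of_int k + 1) * (3 * r - 1 - 2 * of_int k) / 2" for k
    unfolding c2[OF shift_mem[OF mem, of k]]
    by (simp add: rho_coeff_2 \<kappa>_def field_simps power2_eq_square)
  define b1 b2 b3 b4 where "b1 = c (-2) \<kappa>" "b2 = c (-2) (\<kappa> - 2)"
    "b3 = c (-2) (\<kappa> + 6)" "b4 = c (-2) (\<kappa> + 8)"
  note b = this[symmetric]
  have v1: "c 1 (\<kappa> - 4) = 2 * r + 4" "c 1 \<kappa> = 0" "c 1 (\<kappa> - 6) = 3 * (r + 3)"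
    "c 1 (\<kappa> - 2) = r + 1" "c 1 (\<kappa> + 4) = 4 - 2 * r" "c 1 (\<kappa> + 2) = 1 - r"
    "c 1 (\<kappa> + 6) = 3 * (3 - r)"
    using c1[of "-2"] c1[of 0] c1[of "-3"] c1[of "-1"] c1[of 2] c1[of 1] c1[of 3]
    by (simp_all add: algebra_simps)
  have v2: "c 2 (\<kappa> - 4) = 3 * (r + 1)" "c 2 \<kappa> = 0" "c 2 (\<kappa> - 6) = 3 * (3 * r + 5)"
    "c 2 (\<kappa> - 2) = 0" "c 2 (\<kappa> + 4) = 3 * (3 * r - 5)"
    using c2[of "-2"] c2[of 0] c2[of "-3"] c2[of "-1"] c2[of 2]
    by (simp_all add: algebra_simps add_divide_distrib diff_divide_distrib)
  have e1: "b1 * (2 * r + 4) = 3"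
    using c_neg2_shift[OF mem] by (simp add: v1 b)
  have e2: "3 * b2 * (r + 3) - (r + 1) * b1 = 3"
    using c_neg2_shift[OF mems(6)] by (simp add: v1 b algebra_simps)
  have e3: "3 * b1 * (r + 1) = 2 * (r + 1) + g"
    using L2[OF mem] by (simp add: v2 b g) (simp add: \<kappa>_def algebra_simps)
  have e4: "3 * b2 * (3 * r + 5) = 2 * (r + 3) + g"
    using L2[OF mems(6)] by (simp add: v2 b g) (simp add: \<kappa>_def algebra_simps)
  have e5: "b3 * (2 * r - 4) = 3"
    using c_neg2_shift[OF mems(3)] by (simp add: v1 b algebra_simps)
  have e6: "b3 * (1 - r) - 3 * (3 - r) * b4 = 3"
    using c_neg2_shift[OF mems(4)] by (simp add: v1 b add.commute[of 2 \<kappa>] add.commute[of 8 \<kappa>])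
  have e7: "- 3 * (3 * r - 5) * b4 = 2 * r - 6 + g"
    using L2[OF mems(3)] by (simp add: v2 b g add.commute[of 8 \<kappa>]) (simp add: \<kappa>_def algebra_simps)
  (* Each equation below is an explicit linear combination of the relations above with polynomial
     coefficients in r, so that no case distinction about vanishing denominators is needed. *)
  have g_eq: "2 * (r + 2) * g = (r + 1) * (1 - 4 * r)"
  proof -
    have "2 * (r + 2) * g - (r + 1) * (1 - 4 * r)
      = 3 * (r + 1) * (b1 * (2 * r + 4) - 3) - 2 * (r + 2) * (3 * b1 * (r + 1) - (2 * (r + 1) + g))"
      by (simp add: algebra_simps)
    then show ?thesis by (simp add: e1 e3)
  qed
  have b2_eq: "2 * (r + 2) * (r + 3) * b2 = 3 * r + 5"
  proof -
    have "3 * (2 * (r + 2) * (r + 3) * b2 - (3 * r + 5))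
      = 2 * (r + 2) * (3 * b2 * (r + 3) - (r + 1) * b1 - 3) + (r + 1) * (b1 * (2 * r + 4) - 3)"
      by (simp add: algebra_simps)
    then show ?thesis
      by (simp only: e1 e2 diff_self mult_zero_right add_0 mult_eq_0_iff) simp
  qed
  have b4_eq: "(3 - r) * (2 * r - 4) * b4 = 5 - 3 * r"
  proof -
    have "3 * ((3 - r) * (2 * r - 4) * b4 - (5 - 3 * r))
      = (1 - r) * (b3 * (2 * r - 4) - 3) - (2 * r - 4) * (b3 * (1 - r) - 3 * (3 - r) * b4 - 3)"
      by (simp add: algebra_simps)
    then show ?thesis
      by (simp only: e5 e6 diff_self mult_zero_right add_0 mult_eq_0_iff) simp
  qed
  have "r * (10 * r + 14)
    = 2 * (r + 2) * (r + 3) * (3 * b2 * (3 * r + 5) - (2 * (r + 3) + g))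
      - 3 * (3 * r + 5) * (2 * (r + 2) * (r + 3) * b2 - (3 * r + 5))
      + (r + 3) * (2 * (r + 2) * g - (r + 1) * (1 - 4 * r))"
    by (simp add: algebra_simps)
  then have "r * (10 * r + 14) = 0"
    by (simp only: e4 b2_eq g_eq) simp
  then have "r = 0 \<or> 10 * r + 14 = 0"
    by (simp only: mult_eq_0_iff)
  moreover have "r = (10 * r + 14) / 10 - 7 / 5"
    by (simp add: field_simps)
  ultimately have cases: "r = 0 \<or> r = - 7 / 5"
    by auto
  have "2 * (3 * (3 * r - 5)\<^sup>2 * (r + 2) + 4 * (r - 3)\<^sup>2 * (r\<^sup>2 - 4)
      - (3 - r) * (r - 2) * (r + 1) * (1 - 4 * r))
    = 2 * (r + 2) * ((3 - r) * (2 * r - 4)) * (- 3 * (3 * r - 5) * b4 - (2 * r - 6 + g))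
      + 3 * (3 * r - 5) * (2 * (r + 2)) * ((3 - r) * (2 * r - 4) * b4 - (5 - 3 * r))
      + (3 - r) * (2 * r - 4) * (2 * (r + 2) * g - (r + 1) * (1 - 4 * r))"
    by (simp add: algebra_simps power2_eq_square)
  then have "2 * (3 * (3 * r - 5)\<^sup>2 * (r + 2) + 4 * (r - 3)\<^sup>2 * (r\<^sup>2 - 4)
      - (3 - r) * (r - 2) * (r + 1) * (1 - 4 * r)) = 0"
    by (simp only: e7 b4_eq g_eq) simp
  with cases show False
    by (auto simp: power2_eq_square)
qed

lemma c_3_eq:
  assumes mu: "\<mu> \<in> \<xi>" and r: "r\<^sup>2 = \<tau>" and c2: "\<And>\<mu>. \<mu> \<in> \<xi> \<Longrightarrow> c 2 \<mu> = rho_coeff r 2 \<mu>"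
  shows "c 3 \<mu> = (\<mu> - 3 * (r - 1)) * (1 + \<mu> + r) * (3 + \<mu> + r) * (5 + \<mu> + r) / 16"
  unfolding c_3[OF mu] c2[OF mu] c2[OF shift_mem_numeral(1)[OF mu]] c_1[OF mu]
    c_1[OF shift_mem_numeral(2)[OF mu]] r[symmetric]
  by (simp add: rho_coeff_2 field_simps power2_eq_square)

end

text \<open>
  If \<open>\<tau> \<noteq> (\<mu> + 1)\<^sup>2\<close> for all weights, \<open>L\<^sub>1\<close> is invertible. The difference \<open>D\<close> of two candidates for \<open>L\<^bsub>-2\<^esub>\<close>
  commutes with \<open>L\<^sub>1\<close> and \<open>L\<^sub>3\<close>. The first makes its coefficient \<open>d\<close> a multiple of the coefficient of
  \<open>L\<^sub>1\<^sup>-\<^sup>2\<close>, so \<open>d\<close> vanishes everywhere or nowhere; the second forces \<open>d(\<mu>) Q(\<mu>) = 0\<close> for a quadratic polynomial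
  \<open>Q\<close>, which cannot vanish on all of \<open>\<xi>\<close>. With \<open>L\<^bsub>-2\<^esub>\<close> and \<open>L\<^sub>2\<close> known, brackets with \<open>L\<^bsub>-1\<^esub>\<close> and \<open>L\<^sub>1\<close>
  yield the other \<open>L\<^sub>i\<close>, and \<open>[L\<^sub>2, L\<^bsub>-2\<^esub>]\<close> yields \<open>C\<close>.
\<close>

lemma weight_coefficients_unique:
  assumes "weight_coefficients \<xi> \<tau> c \<gamma>" "weight_coefficients \<xi> \<tau> c' \<gamma>'"
    and c2: "\<And>\<mu>. \<mu> \<in> \<xi> \<Longrightarrow> c 2 \<mu> = c' 2 \<mu>"
    and nz: "\<And>\<mu>. \<mu> \<in> \<xi> \<Longrightarrow> \<tau> \<noteq> (\<mu> + 1)\<^sup>2"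
    and mu: "\<mu> \<in> \<xi>"
  shows "c i \<mu> = c' i \<mu>" "\<gamma> \<mu> = \<gamma>' \<mu>"
proof -
  interpret c: weight_coefficients \<xi> \<tau> c \<gamma> by fact
  interpret c': weight_coefficients \<xi> \<tau> c' \<gamma>' by fact
  note mem = c.shift_mem_numeral
  obtain r where r': "r \<in> {csqrt \<tau>, - csqrt \<tau>}" and c2r: "\<And>\<mu>. \<mu> \<in> \<xi> \<Longrightarrow> c 2 \<mu> = rho_coeff r 2 \<mu>"
    using c.c_2_cases[OF power2_csqrt] by blast
  have r: "r\<^sup>2 = \<tau>"
    using r' by auto
  have c1: "c' 1 \<nu> = c 1 \<nu>" if "\<nu> \<in> \<xi>" for \<nu>
    using that by (simp add: c.c_1 c'.c_1)
  have c1_eq: "c 1 \<nu> = (1 + \<nu> + r) * (1 + \<nu> - r) / 4" if "\<nu> \<in> \<xi>" for \<nu>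
    unfolding c.c_1[OF that] r[symmetric] by (simp add: field_simps power2_eq_square)
  have c1_nz: "c 1 \<nu> \<noteq> 0" if "\<nu> \<in> \<xi>" for \<nu>
    using nz[OF that] c.c_1[OF that] by auto
  have nz': "1 + \<nu> + r \<noteq> 0" if "\<nu> \<in> \<xi>" for \<nu>
    using c1_nz[OF that] c1_eq[OF that] by auto
  have c3: "c' 3 \<nu> = c 3 \<nu>" if "\<nu> \<in> \<xi>" for \<nu>
    using that mem[OF that] by (simp add: c.c_3 c'.c_3 c1 c2)
  define d where "d \<nu> = c (-2) \<nu> - c' (-2) \<nu>" for \<nu>
  have d1: "d \<nu> * c 1 (\<nu> - 4) = c 1 \<nu> * d (\<nu> + 2)" if "\<nu> \<in> \<xi>" for \<nu>
    using c.c_neg2_shift[OF that] c'.c_neg2_shift[OF that] c1[OF that] c1[OF mem(6)[OF that]]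
    by (simp add: d_def algebra_simps)
  have d3: "d \<nu> * c 3 (\<nu> - 4) = c 3 \<nu> * d (\<nu> + 6)" if "\<nu> \<in> \<xi>" for \<nu>
    using c.c_neg2_c_3[OF that] c'.c_neg2_c_3[OF that] c1[OF that] c3[OF that] c3[OF mem(6)[OF that]]
    by (simp add: d_def algebra_simps)
  (* Three steps of d1 turn d3 into the product of d with a polynomial. Q is what remains of it after
     division by factors of c 1 at neighbouring weights, which are nonzero. *)
  define Q where "Q \<nu> = (3 * r + 1 - \<nu>) * (5 + \<nu> - r) * (3 + \<nu> - r)
    - (3 * r - 3 - \<nu>) * (\<nu> - 3 - r) * (\<nu> - 1 - r)" for \<nu>
  have dQ: "d \<nu> * Q \<nu> = 0" if "\<nu> \<in> \<xi>" for \<nu>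
  proof -
    note m = that mem[OF that]
    have d2: "d (\<nu> + 2) * c 1 (\<nu> - 2) = c 1 (\<nu> + 2) * d (\<nu> + 4)"
      and d4: "d (\<nu> + 4) * c 1 \<nu> = c 1 (\<nu> + 4) * d (\<nu> + 6)"
      using d1[OF m(2)] d1[OF m(3)] by (simp_all add: add.assoc)
    have "d \<nu> * (c 1 (\<nu> - 4) * c 1 (\<nu> - 2) * c 1 \<nu>) = c 1 \<nu> * c 1 (\<nu> + 2) * c 1 (\<nu> + 4) * d (\<nu> + 6)"
      using d1[OF m(1)] d2 d4 by algebra
    then have "c 1 \<nu> * (d \<nu> * (c 3 (\<nu> - 4) * c 1 (\<nu> + 2) * c 1 (\<nu> + 4)
        - c 3 \<nu> * c 1 (\<nu> - 4) * c 1 (\<nu> - 2))) = 0"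
      using d3[OF that] by algebra
    then have *: "d \<nu> * (c 3 (\<nu> - 4) * c 1 (\<nu> + 2) * c 1 (\<nu> + 4)
        - c 3 \<nu> * c 1 (\<nu> - 4) * c 1 (\<nu> - 2)) = 0"
      using c1_nz[OF that] by simp
    define z where "z = 1 + \<nu> + r"
    have "c 3 (\<nu> - 4) * c 1 (\<nu> + 2) * c 1 (\<nu> + 4) - c 3 \<nu> * c 1 (\<nu> - 4) * c 1 (\<nu> - 2)
      = (z - 4) * (z - 2) * z * (z + 2) * (z + 4) * Q \<nu> / (- 256)"
      using m by (simp add: c1_eq c.c_3_eq[OF _ r c2r]) (simp add: z_def Q_def field_simps)
    with * have "d \<nu> * ((z - 4) * (z - 2) * z * (z + 2) * (z + 4) * Q \<nu> / (- 256)) = 0"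
      by simp
    moreover have "z - 4 \<noteq> 0" "z - 2 \<noteq> 0" "z \<noteq> 0" "z + 2 \<noteq> 0" "z + 4 \<noteq> 0"
      using nz'[OF m(1)] nz'[OF m(2)] nz'[OF m(3)] nz'[OF m(6)] nz'[OF m(7)]
      by (simp_all add: z_def algebra_simps)
    ultimately show ?thesis by simp
  qed
  have d0: "d \<nu> = 0" if "\<nu> \<in> \<xi>" for \<nu>
  proof (rule ccontr)
    assume "d \<nu> \<noteq> 0"
    note m = that mem[OF that]
    have "d (\<nu> + 2) \<noteq> 0"
      using d1[OF that] \<open>d \<nu> \<noteq> 0\<close> c1_nz[OF m(7)] by auto
    moreover from this have "d (\<nu> + 4) \<noteq> 0"
      using d1[OF m(2)] c1_nz[OF m(6)] by (auto simp: add.assoc)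
    ultimately have "Q \<nu> = 0" "Q (\<nu> + 2) = 0" "Q (\<nu> + 4) = 0"
      using dQ[OF m(1)] dQ[OF m(2)] dQ[OF m(3)] \<open>d \<nu> \<noteq> 0\<close> by auto
    (* The second difference of a quadratic polynomial is constant. *)
    moreover have "Q \<nu> - 2 * Q (\<nu> + 2) + Q (\<nu> + 4) = - 64"
      by (simp add: Q_def algebra_simps)
    ultimately show False by simp
  qed
  have pos: "\<forall>\<nu>\<in>\<xi>. c i \<nu> = c' i \<nu>" if "i \<ge> 2" for i
    using that
  proof (induction i rule: int_ge_induct)
    case base then show ?case using c2 by simp
  next
    case (step i)
    show ?case
    proof
      fix \<nu> assume m: "\<nu> \<in> \<xi>"
      show "c (i + 1) \<nu> = c' (i + 1) \<nu>"
        using c.c_bracket[OF m, of i 1] c'.c_bracket[OF m, of i 1] step m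
          c.shift_mem[OF m, of 1] c.shift_mem[OF m, of i]
        by (auto simp: c1 add.commute)
    qed
  qed
  have neg: "\<forall>\<nu>\<in>\<xi>. c i \<nu> = c' i \<nu>" if "i \<le> - 2" for i
    using that
  proof (induction i rule: int_le_induct)
    case base then show ?case using d0 by (simp add: d_def)
  next
    case (step i)
    show ?case
    proof
      fix \<nu> assume m: "\<nu> \<in> \<xi>"
      have "of_int (- 1) \<noteq> (of_int i :: complex)" using step unfolding of_int_eq_iff by simp
      then show "c (i - 1) \<nu> = c' (i - 1) \<nu>"
        using c.c_bracket[OF m, of i "-1"] c'.c_bracket[OF m, of i "-1"] step m
          c.shift_mem[OF m, of "-1"] c.shift_mem[OF m, of i]
        by (auto simp: c.c_neg1 c'.c_neg1)
    qed
  qed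
  have eq: "c i \<nu> = c' i \<nu>" if "\<nu> \<in> \<xi>" for i \<nu>
  proof -
    consider "i \<le> - 2" | "i = - 1" | "i = 0" | "i = 1" | "i \<ge> 2" by linarith
    then show ?thesis
      using pos neg that by cases (auto simp: c.c_neg1 c'.c_neg1 c.c_0 c'.c_0 c1)
  qed
  show "c i \<mu> = c' i \<mu>" by (rule eq[OF mu])
  show "\<gamma> \<mu> = \<gamma>' \<mu>"
    using c.c_bracket[OF mu, of "-2" 2] c'.c_bracket[OF mu, of "-2" 2] mem[OF mu]
    by (simp add: eq mu)
qed

section \<open>From structures to coefficients\<close>

definition structure_coeff ::
    "(vir \<Rightarrow> (complex \<Rightarrow>\<^sub>0 complex) \<Rightarrow> (complex \<Rightarrow>\<^sub>0 complex)) \<Rightarrow> int \<Rightarrow> complex \<Rightarrow> complex" where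
  "structure_coeff act i \<mu> =
     Poly_Mapping.lookup (act (basis_vec (Vir_L i)) (basis_vec \<mu>)) (\<mu> + 2 * of_int i)"

definition structure_charge ::
    "(vir \<Rightarrow> (complex \<Rightarrow>\<^sub>0 complex) \<Rightarrow> (complex \<Rightarrow>\<^sub>0 complex)) \<Rightarrow> complex \<Rightarrow> complex" where
  "structure_charge act \<mu> =
     Poly_Mapping.lookup (act (basis_vec Vir_C) (basis_vec \<mu>)) \<mu>"

lemma lookup_dense_act_h:
  "Poly_Mapping.lookup (dense_act \<tau> (basis_vec Sl_h) v) \<nu> = \<nu> * Poly_Mapping.lookup v \<nu>"
proof (induction v rule: pm_induct)
  case (single k c)
  then show ?case by (auto simp: dense_act_def lookup_single when_def)
qed (simp_all add: dense_act_def bilin_ext_linear lookup_add algebra_simps)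

locale vir_structure =
  fixes \<xi> \<tau> act
  assumes coset: "\<xi> \<in> C_mod_2Z" and act: "act \<in> vir_structures \<xi> \<tau>"
begin

sublocale lie_module pm_scale vir_bracket pm_scale "dense_space \<xi>" act
  using act by (simp add: compatible_structures_def)

lemma act_sl2: "v \<in> dense_space \<xi> \<Longrightarrow> act (sl2_to_vir x) v = dense_act \<tau> x v"
  using act by (simp add: compatible_structures_def)

lemma act_L0:
  assumes "v \<in> dense_space \<xi>"
  shows "Poly_Mapping.lookup (act (basis_vec (Vir_L 0)) v) \<nu> = - \<nu> / 2 * Poly_Mapping.lookup v \<nu>"
proof -
  have "basis_vec (Vir_L 0) = (- 1 / 2) *\<^sub>C sl2_to_vir (basis_vec Sl_h)"
    by (simp add: sl2_to_vir_def)
  then show ?thesis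
    by (simp only: act_scale_left[OF assms] act_sl2[OF assms] lookup_pm_scale lookup_dense_act_h) simp
qed

lemma act_Lneg1:
  assumes "\<mu> \<in> \<xi>"
  shows "act (basis_vec (Vir_L (-1))) (basis_vec \<mu>) = basis_vec (\<mu> - 2)"
proof -
  have "basis_vec (Vir_L (-1)) = sl2_to_vir (basis_vec Sl_f)"
    by (simp add: sl2_to_vir_def)
  then show ?thesis
    using assms by (simp add: act_sl2 dense_act_def dense_space_def)
qed

lemma act_L1:
  assumes "\<mu> \<in> \<xi>"
  shows "act (basis_vec (Vir_L 1)) (basis_vec \<mu>) = Poly_Mapping.single (\<mu> + 2) (((\<mu> + 1)\<^sup>2 - \<tau>) / 4)"
proof -
  have "basis_vec (Vir_L 1) = sl2_to_vir (- basis_vec Sl_e)"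
    by (simp add: sl2_to_vir_def single_uminus)
  then show ?thesis
    using assms by (simp add: act_sl2 dense_act_def dense_space_def single_uminus)
qed

lemma basis_mem: "\<mu> \<in> \<xi> \<Longrightarrow> Poly_Mapping.single \<mu> a \<in> dense_space \<xi>"
  by (simp add: dense_space_def)

text \<open>
  Since \<open>L\<^sub>0\<close> acts as \<open>- h / 2\<close>, the bracket with \<open>L\<^sub>0\<close> shows that \<open>x\<close> moves \<open>v\<^sub>\<mu>\<close> into the eigenspace of \<open>h\<close> for \<open>\<mu> + 2 i\<close>, which is
  one-dimensional.
\<close>

lemma act_weight:
  assumes mu: "\<mu> \<in> \<xi>" and x: "vir_bracket (basis_vec (Vir_L 0)) x = (- of_int i) *\<^sub>C x"
  shows "act x (basis_vec \<mu>) = Poly_Mapping.single (\<mu> + 2 * of_int i)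
    (Poly_Mapping.lookup (act x (basis_vec \<mu>)) (\<mu> + 2 * of_int i))"
proof (rule poly_mapping_eqI)
  fix \<nu>
  let ?w = "act x (basis_vec \<mu>)"
  have L0: "act (basis_vec (Vir_L 0)) (basis_vec \<mu>) = (- \<mu> / 2) *\<^sub>C basis_vec \<mu>"
    by (rule poly_mapping_eqI) (simp add: act_L0[OF basis_mem[OF mu]] lookup_single when_def)
  have "act (vir_bracket (basis_vec (Vir_L 0)) x) (basis_vec \<mu>)
      = act (basis_vec (Vir_L 0)) ?w - act x (act (basis_vec (Vir_L 0)) (basis_vec \<mu>))"
    using act_bracket basis_mem[OF mu] .
  then have "(- of_int i) *\<^sub>C ?w = act (basis_vec (Vir_L 0)) ?w - (- \<mu> / 2) *\<^sub>C ?w"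
    by (simp only: x act_scale_left act_scale basis_mem[OF mu] L0)
  then have "Poly_Mapping.lookup ((- of_int i) *\<^sub>C ?w) \<nu>
    = Poly_Mapping.lookup (act (basis_vec (Vir_L 0)) ?w - (- \<mu> / 2) *\<^sub>C ?w) \<nu>"
    by (simp only:)
  then have "(\<nu> - (\<mu> + 2 * of_int i)) * Poly_Mapping.lookup ?w \<nu> = 0"
    by (simp only: lookup_minus lookup_pm_scale act_L0[OF act_closed[OF basis_mem[OF mu]]])
      (simp add: field_simps)
  then show "Poly_Mapping.lookup ?w \<nu> = Poly_Mapping.lookup (Poly_Mapping.single (\<mu> + 2 * of_int i)
      (Poly_Mapping.lookup ?w (\<mu> + 2 * of_int i))) \<nu>"
    by (auto simp: lookup_single when_def)
qed

lemma act_L: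
  assumes "\<mu> \<in> \<xi>"
  shows "act (basis_vec (Vir_L i)) (basis_vec \<mu>)
    = Poly_Mapping.single (\<mu> + 2 * of_int i) (structure_coeff act i \<mu>)"
  unfolding structure_coeff_def by (rule act_weight[OF assms]) (simp add: vir_bracket_def)

lemma act_C:
  assumes "\<mu> \<in> \<xi>"
  shows "act (basis_vec Vir_C) (basis_vec \<mu>) = Poly_Mapping.single \<mu> (structure_charge act \<mu>)"
  using act_weight[OF assms, of "basis_vec Vir_C" 0]
  by (simp add: vir_bracket_def structure_charge_def)

lemma mem_shift: "\<mu> \<in> \<xi> \<Longrightarrow> \<mu> + 2 * of_int i \<in> \<xi>"
  by (rule C_mod_2Z_shift[OF coset])

lemma weight_coefficients: "weight_coefficients \<xi> \<tau> (structure_coeff act) (structure_charge act)"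
proof
  have act_single: "act x (a *\<^sub>C basis_vec \<mu>) = a *\<^sub>C act x (basis_vec \<mu>)" if "\<mu> \<in> \<xi>" for x \<mu> a
    using act_scale[OF basis_mem[OF that]] .
  have L_single: "act (basis_vec (Vir_L i)) (Poly_Mapping.single \<mu> a)
      = Poly_Mapping.single (\<mu> + 2 * of_int i) (a * structure_coeff act i \<mu>)" if "\<mu> \<in> \<xi>" for i \<mu> a
    using act_single[OF that, of "basis_vec (Vir_L i)" a] by (simp add: act_L[OF that])
  show "\<xi> \<in> C_mod_2Z" by (rule coset)
  show "structure_coeff act (-1) \<mu> = 1" if "\<mu> \<in> \<xi>" for \<mu>
    by (simp add: structure_coeff_def act_Lneg1[OF that])
  show "structure_coeff act 0 \<mu> = - \<mu> / 2" if "\<mu> \<in> \<xi>" for \<mu>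
    by (simp add: structure_coeff_def act_L0[OF basis_mem[OF that]])
  show "structure_coeff act 1 \<mu> = ((\<mu> + 1)\<^sup>2 - \<tau>) / 4" if "\<mu> \<in> \<xi>" for \<mu>
    by (simp add: structure_coeff_def act_L1[OF that])
  show "structure_charge act (\<mu> + 2) = structure_charge act \<mu>" if mu: "\<mu> \<in> \<xi>" for \<mu>
  proof -
    have mu2: "\<mu> + 2 \<in> \<xi>" using mem_shift[OF mu, of 1] by simp
    have "act (vir_bracket (basis_vec Vir_C) (basis_vec (Vir_L (-1)))) (basis_vec (\<mu> + 2))
      = act (basis_vec Vir_C) (act (basis_vec (Vir_L (-1))) (basis_vec (\<mu> + 2)))
        - act (basis_vec (Vir_L (-1))) (act (basis_vec Vir_C) (basis_vec (\<mu> + 2)))"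
      using act_bracket basis_mem[OF mu2] .
    moreover have "vir_bracket (basis_vec Vir_C) (basis_vec (Vir_L (-1))) = 0 *\<^sub>C basis_vec Vir_C"
      by (simp add: vir_bracket_def)
    moreover have "act (0 *\<^sub>C basis_vec Vir_C) (basis_vec (\<mu> + 2)) = 0"
      using act_scale_left[OF basis_mem[OF mu2], of 0 "basis_vec Vir_C" 1] by simp
    moreover have "act (basis_vec (Vir_L (-1))) (Poly_Mapping.single (\<mu> + 2) a) = Poly_Mapping.single \<mu> a" for a
      using act_single[OF mu2, of "basis_vec (Vir_L (-1))" a] by (simp add: act_Lneg1[OF mu2])
    ultimately have "Poly_Mapping.single \<mu> (structure_charge act \<mu> - structure_charge act (\<mu> + 2)) = 0"
      by (simp add: act_Lneg1 act_C mu mu2 single_diff)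
    then have "structure_charge act \<mu> - structure_charge act (\<mu> + 2) = 0"
      by (metis lookup_single_eq lookup_zero)
    then show ?thesis by simp
  qed
  fix \<mu> i j assume mu: "\<mu> \<in> \<xi>"
  let ?c = "structure_coeff act" and ?L = "\<lambda>i. basis_vec (Vir_L i)"
  let ?z = "if i + j = 0 then of_int (i ^ 3 - i) / 12 else 0 :: complex"
  have idx: "\<mu> + 2 * of_int j + 2 * of_int i = \<mu> + 2 * of_int (i + j)" for i j
    by (simp add: algebra_simps)
  have comp: "act (?L i) (act (?L j) (basis_vec \<mu>)) = Poly_Mapping.single (\<mu> + 2 * of_int (i + j))
      (?c j \<mu> * ?c i (\<mu> + 2 * of_int j))" for i j
    by (simp only: act_L[OF mu] L_single[OF mem_shift[OF mu]] idx)
  have "act (vir_bracket (?L i) (?L j)) (basis_vec \<mu>)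
    = act (?L i) (act (?L j) (basis_vec \<mu>)) - act (?L j) (act (?L i) (basis_vec \<mu>))"
    using act_bracket basis_mem[OF mu] .
  also have "\<dots> = Poly_Mapping.single (\<mu> + 2 * of_int (i + j))
      (?c j \<mu> * ?c i (\<mu> + 2 * of_int j) - ?c i \<mu> * ?c j (\<mu> + 2 * of_int i))"
    by (simp only: comp single_diff add.commute[of j i])
  also have "vir_bracket (?L i) (?L j) = of_int (i - j) *\<^sub>C ?L (i + j) + ?z *\<^sub>C basis_vec Vir_C"
    by (simp add: vir_bracket_def)
  also have "act \<dots> (basis_vec \<mu>) = of_int (i - j) *\<^sub>C act (?L (i + j)) (basis_vec \<mu>)
      + ?z *\<^sub>C act (basis_vec Vir_C) (basis_vec \<mu>)"
    by (simp only: act_add_left act_scale_left basis_mem[OF mu])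
  also have "\<dots> = Poly_Mapping.single (\<mu> + 2 * of_int (i + j))
      (of_int (i - j) * ?c (i + j) \<mu> + ?z * structure_charge act \<mu>)"
    by (cases "i + j = 0") (simp_all add: act_L act_C mu single_add)
  finally have "of_int (i - j) * ?c (i + j) \<mu> + ?z * structure_charge act \<mu>
     = ?c j \<mu> * ?c i (\<mu> + 2 * of_int j) - ?c i \<mu> * ?c j (\<mu> + 2 * of_int i)"
    by (metis lookup_single_eq)
  then show "?c j \<mu> * ?c i (\<mu> + 2 * of_int j) - ?c i \<mu> * ?c j (\<mu> + 2 * of_int i)
        = of_int (i - j) * ?c (i + j) \<mu>
          + (if i + j = 0 then of_int (i ^ 3 - i) / 12 * structure_charge act \<mu> else 0)"
    by (cases "i + j = 0") simp_all
qed

end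

lemma vir_structure_eqI:
  assumes "vir_structure \<xi> \<tau> act" "vir_structure \<xi> \<tau> act'"
    and L: "\<And>i \<mu>. \<mu> \<in> \<xi> \<Longrightarrow> structure_coeff act i \<mu> = structure_coeff act' i \<mu>"
    and C: "\<And>\<mu>. \<mu> \<in> \<xi> \<Longrightarrow> structure_charge act \<mu> = structure_charge act' \<mu>"
  shows "act = act'"
proof (intro ext)
  interpret A: vir_structure \<xi> \<tau> act by fact
  interpret B: vir_structure \<xi> \<tau> act' by fact
  have basis: "act (basis_vec b) (basis_vec \<mu>) = act' (basis_vec b) (basis_vec \<mu>)" if "\<mu> \<in> \<xi>" for b \<mu>
    by (cases b) (simp_all add: A.act_L B.act_L A.act_C B.act_C L C that)
  fix x v
  show "act x v = act' x v"
  proof (cases "v \<in> dense_space \<xi>")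
    case True
    show ?thesis
    proof (induction x rule: pm_induct)
      case zero
      show ?case
        using A.act_scale_left[OF True, of 0 0] B.act_scale_left[OF True, of 0 0] by simp
    next
      case (single b a)
      have "v \<in> dense_space \<xi> \<and> act (basis_vec b) v = act' (basis_vec b) v"
      proof (induction v rule: pm_induct)
        case zero
        have "(0 :: complex \<Rightarrow>\<^sub>0 complex) \<in> dense_space \<xi>" by (simp add: dense_space_def)
        then show ?case
          using A.act_scale[of 0 "basis_vec b" 0] B.act_scale[of 0 "basis_vec b" 0] by simp
      next
        case (single \<mu> d)
        then have "\<mu> \<in> \<xi>" using True by (auto simp: dense_space_def)
        then show ?case
          using A.act_scale[OF A.basis_mem, of \<mu> "basis_vec b" d 1]
            B.act_scale[OF B.basis_mem, of \<mu> "basis_vec b" d 1]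
          by (simp add: basis A.basis_mem)
      next
        case (add u w)
        then show ?case
          using pm.subspace_add[OF A.subspace] by (simp add: A.act_add B.act_add)
      qed
      then show ?case
        using A.act_scale_left[OF True, of a "basis_vec b"] B.act_scale_left[OF True, of a "basis_vec b"]
        by simp
    next
      case (add x y)
      then show ?case by (simp add: A.act_add_left B.act_add_left True)
    qed
  next
    case False
    have "act x \<in> extensional (dense_space \<xi>)" "act' x \<in> extensional (dense_space \<xi>)"
      using A.act B.act by (simp_all add: compatible_structures_def)
    then show ?thesis
      using False by (simp add: extensional_def)
  qed
qed

section \<open>Simplicity of the dense module\<close>

text \<open>
  If \<open>\<tau> = (\<mu> + 1)\<^sup>2\<close>, then \<open>e v\<^sub>\<mu> = 0\<close>, so the \<open>v\<^sub>\<nu>\<close> with \<open>\<nu> = \<mu>, \<mu> - 2, \<mu> - 4, \<dots>\<close> span a proper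
  submodule.
\<close>

lemma simple_dense_imp_neq_square:
  assumes coset: "\<xi> \<in> C_mod_2Z" and mu: "\<mu> \<in> \<xi>"
    and simple: "simple_lie_module pm_scale sl2_bracket pm_scale (dense_space \<xi>) (dense_act \<tau>)"
  shows "\<tau> \<noteq> (\<mu> + 1)\<^sup>2"
proof
  assume \<tau>: "\<tau> = (\<mu> + 1)\<^sup>2"
  define S where "S = {\<mu> - 2 * of_nat k | k. True}"
  have sub: "S \<subseteq> \<xi>"
  proof
    fix \<nu> assume "\<nu> \<in> S"
    then obtain k where "\<nu> = \<mu> + 2 * of_int (- int k)" by (auto simp: S_def)
    then show "\<nu> \<in> \<xi>" by (simp only: C_mod_2Z_shift[OF coset mu])
  qed
  have mu_S: "\<mu> \<in> S" by (auto simp: S_def intro: exI[of _ 0])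
  have above: "\<mu> + 2 \<notin> S"
  proof
    assume "\<mu> + 2 \<in> S"
    then obtain k where "\<mu> + 2 = \<mu> - 2 * of_nat k" by (auto simp: S_def)
    then have "2 * of_nat (k + 1) = (0 :: complex)" by (simp add: algebra_simps)
    then have "of_nat (k + 1) = (0 :: complex)" by (metis mult_eq_0_iff zero_neq_numeral)
    then show False unfolding of_nat_eq_0_iff by simp
  qed
  have down: "\<nu> - 2 \<in> S" if "\<nu> \<in> S" for \<nu>
  proof -
    from that obtain k where "\<nu> = \<mu> - 2 * of_nat k" by (auto simp: S_def)
    then have "\<nu> - 2 = \<mu> - 2 * of_nat (Suc k)" by (simp add: algebra_simps)
    then show ?thesis unfolding S_def by blast
  qed
  have up: "\<nu> = \<mu> \<or> \<nu> + 2 \<in> S" if "\<nu> \<in> S" for \<nu>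
  proof -
    from that obtain k where k: "\<nu> = \<mu> - 2 * of_nat k" by (auto simp: S_def)
    show ?thesis
    proof (cases k)
      case 0 then show ?thesis using k by simp
    next
      case (Suc l)
      then have "\<nu> + 2 = \<mu> - 2 * of_nat l" using k by (simp add: algebra_simps)
      then show ?thesis unfolding S_def by blast
    qed
  qed
  have closed: "Poly_Mapping.keys (dense_basis_act \<tau> a \<nu>) \<subseteq> S" if "\<nu> \<in> S" for a \<nu>
    using down[OF that] up[OF that] that by (cases a) (auto simp: \<tau>)
  let ?W = "{v :: complex \<Rightarrow>\<^sub>0 complex. Poly_Mapping.keys v \<subseteq> S}"
  have "lie_module pm_scale sl2_bracket pm_scale ?W (dense_act \<tau>)"
  proof (rule lie_module_submodule[OF dense_lie_module[OF coset]])
    show "?W \<subseteq> dense_space \<xi>" using sub by (auto simp: dense_space_def)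
    show "pm.subspace ?W" by (rule supported_subspace)
    show "dense_act \<tau> x v \<in> ?W" if "v \<in> ?W" for x v
      using that bilin_ext_keys[where n = "dense_basis_act \<tau>" and S = S and v = v and x = x, OF closed]
      by (simp add: dense_act_def)
  qed
  moreover have "?W \<subseteq> dense_space \<xi>" using sub by (auto simp: dense_space_def)
  ultimately have "?W = {0} \<or> ?W = dense_space \<xi>"
    using simple unfolding simple_lie_module_def by blast
  moreover have "basis_vec \<mu> \<in> ?W"
    using mu_S by simp
  moreover have "basis_vec \<mu> \<noteq> (0 :: complex \<Rightarrow>\<^sub>0 complex)"
    by (metis lookup_single_eq lookup_zero zero_neq_one)
  moreover have "basis_vec (\<mu> + 2) \<in> dense_space \<xi>" "basis_vec (\<mu> + 2) \<notin> ?W"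
    using above C_mod_2Z_shift[OF coset mu, of 1] by (simp_all add: dense_space_def)
  ultimately show False by blast
qed

section \<open>Classification\<close>

lemma rho_coeff_2_diff: "rho_coeff r 2 \<mu> - rho_coeff (- r) 2 \<mu> = r * (r\<^sup>2 - 1) / 2"
  by (simp add: rho_coeff_2 field_simps power2_eq_square)

lemma rho_vir_structure:
  assumes "\<xi> \<in> C_mod_2Z" "r\<^sup>2 = \<tau>" "1 - r \<notin> \<xi>"
  shows "rho_vir \<xi> r \<in> vir_structures \<xi> \<tau>"
  unfolding rho_vir_pullback
  using witt_structures_pullback[OF rho_witt_structure[OF assms]] .

lemma structure_coeff_rho_vir:
  assumes "\<mu> \<in> \<xi>"
  shows "structure_coeff (rho_vir \<xi> r) i \<mu> = rho_coeff r i \<mu>"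
  using assms by (simp add: structure_coeff_def rho_vir_def dense_space_def)

lemma vir_structure_imp_root_notin:
  assumes "\<xi> \<in> C_mod_2Z" "s\<^sup>2 = \<tau>" and act: "act \<in> vir_structures \<xi> \<tau>"
  obtains r where "r \<in> {s, - s}" "1 - r \<notin> \<xi>"
    "\<And>\<mu>. \<mu> \<in> \<xi> \<Longrightarrow> structure_coeff act 2 \<mu> = rho_coeff r 2 \<mu>"
proof -
  interpret vir_structure \<xi> \<tau> act
    using assms by unfold_locales
  interpret W: weight_coefficients \<xi> \<tau> "structure_coeff act" "structure_charge act"
    by (rule weight_coefficients)
  obtain r where r: "r \<in> {s, - s}"
    and c2: "\<And>\<mu>. \<mu> \<in> \<xi> \<Longrightarrow> structure_coeff act 2 \<mu> = rho_coeff r 2 \<mu>"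
    using W.c_2_cases[OF assms(2)] by blast
  have "r\<^sup>2 = \<tau>"
    using r assms(2) by auto
  then have "1 - r \<notin> \<xi>"
    using c2 by (rule W.c_2_imp_root_notin)
  then show thesis
    using that r c2 by blast
qed

lemma vir_structures_unique:
  assumes "\<xi> \<in> C_mod_2Z" and nz: "\<And>\<mu>. \<mu> \<in> \<xi> \<Longrightarrow> \<tau> \<noteq> (\<mu> + 1)\<^sup>2"
    and "act \<in> vir_structures \<xi> \<tau>" "act' \<in> vir_structures \<xi> \<tau>"
    and c2: "\<And>\<mu>. \<mu> \<in> \<xi> \<Longrightarrow> structure_coeff act 2 \<mu> = structure_coeff act' 2 \<mu>"
  shows "act = act'"
proof -
  have V: "vir_structure \<xi> \<tau> act" "vir_structure \<xi> \<tau> act'"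
    using assms by (auto intro: vir_structure.intro)
  note W = V[THEN vir_structure.weight_coefficients]
  show ?thesis
    by (rule vir_structure_eqI[OF V]) (use weight_coefficients_unique[OF W c2 nz] in auto)
qed

lemma vir_structures_simple:
  assumes coset: "\<xi> \<in> C_mod_2Z" and s: "s\<^sup>2 = \<tau>"
    and nz: "\<And>\<mu>. \<mu> \<in> \<xi> \<Longrightarrow> \<tau> \<noteq> (\<mu> + 1)\<^sup>2"
  shows "vir_structures \<xi> \<tau> = {rho_vir \<xi> s, rho_vir \<xi> (- s)}"
    and "rho_vir \<xi> s = rho_vir \<xi> (- s) \<longleftrightarrow> \<tau> = 0 \<or> \<tau> = 1"
    and "r \<in> {s, - s} \<Longrightarrow> 1 - r \<notin> \<xi>"
proof -
  have root: "1 - r \<notin> \<xi>" if "r \<in> {s, - s}" for r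
  proof
    assume "1 - r \<in> \<xi>"
    then have "- 1 - r \<in> \<xi>"
      using C_mod_2Z_shift[OF coset, of "1 - r" "-1"] by simp
    then show False
      using nz[of "- 1 - r"] s that by auto
  qed
  then show "r \<in> {s, - s} \<Longrightarrow> 1 - r \<notin> \<xi>" .
  have rho: "rho_vir \<xi> r \<in> vir_structures \<xi> \<tau>" if "r \<in> {s, - s}" for r
    using that s by (intro rho_vir_structure[OF coset _ root]) auto
  have "act \<in> {rho_vir \<xi> s, rho_vir \<xi> (- s)}" if act: "act \<in> vir_structures \<xi> \<tau>" for act
  proof -
    obtain r where r: "r \<in> {s, - s}"
      and c2: "\<And>\<mu>. \<mu> \<in> \<xi> \<Longrightarrow> structure_coeff act 2 \<mu> = rho_coeff r 2 \<mu>"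
      using vir_structure_imp_root_notin[OF coset s act] by metis
    have "act = rho_vir \<xi> r"
      by (rule vir_structures_unique[OF coset nz act rho[OF r]])
        (simp_all add: c2 structure_coeff_rho_vir)
    then show ?thesis
      using r by auto
  qed
  then show "vir_structures \<xi> \<tau> = {rho_vir \<xi> s, rho_vir \<xi> (- s)}"
    using rho[of s] rho[of "- s"] by auto
  obtain \<mu> where mu: "\<mu> \<in> \<xi>"
    using C_mod_2Z_nonempty[OF coset] by blast
  show "rho_vir \<xi> s = rho_vir \<xi> (- s) \<longleftrightarrow> \<tau> = 0 \<or> \<tau> = 1"
  proof
    assume "rho_vir \<xi> s = rho_vir \<xi> (- s)"
    then have "rho_coeff s 2 \<mu> = rho_coeff (- s) 2 \<mu>"
      using structure_coeff_rho_vir[OF mu] by metis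
    then have "s * (\<tau> - 1) / 2 = 0"
      using rho_coeff_2_diff[of s \<mu>] by (simp add: s)
    then show "\<tau> = 0 \<or> \<tau> = 1"
      using s by auto
  next
    assume "\<tau> = 0 \<or> \<tau> = 1"
    then have "s * (\<tau> - 1) / 2 = 0"
      using s by auto
    then have "rho_coeff s 2 \<nu> - rho_coeff (- s) 2 \<nu> = 0" for \<nu>
      unfolding rho_coeff_2_diff s .
    then have "rho_coeff s 2 \<nu> = rho_coeff (- s) 2 \<nu>" for \<nu>
      by simp
    then show "rho_vir \<xi> s = rho_vir \<xi> (- s)"
      by (intro vir_structures_unique[OF coset nz rho rho])
        (simp_all add: structure_coeff_rho_vir)
  qed
qed

theorem proposition4p9:
  fixes \<xi> :: "complex set" and \<tau> s :: complex
  assumes "\<xi> \<in> C_mod_2Z" and "s\<^sup>2 = \<tau>"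
  shows
    "{x :: complex. (x - 1)\<^sup>2 - \<tau> = 0} = {1 + s, 1 - s} \<and>
     (witt_structures \<xi> \<tau> = {} \<longleftrightarrow> {x :: complex. (x - 1)\<^sup>2 - \<tau> = 0} \<subseteq> \<xi>) \<and>
     (vir_structures \<xi> \<tau> = {} \<longleftrightarrow> {x :: complex. (x - 1)\<^sup>2 - \<tau> = 0} \<subseteq> \<xi>) \<and>
     (\<forall>r \<in> {s, - s}. 1 - r \<notin> \<xi> \<longrightarrow>
        rho_witt \<xi> r \<in> witt_structures \<xi> \<tau> \<and> rho_vir \<xi> r \<in> vir_structures \<xi> \<tau>) \<and>
     (simple_lie_module pm_scale sl2_bracket pm_scale (dense_space \<xi>) (dense_act \<tau>) \<longrightarrow>
        witt_structures \<xi> \<tau> = {rho_witt \<xi> s, rho_witt \<xi> (- s)} \<and>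
        vir_structures \<xi> \<tau> = {rho_vir \<xi> s, rho_vir \<xi> (- s)} \<and>
        (\<tau> \<noteq> 0 \<and> \<tau> \<noteq> 1 \<longrightarrow>
           card (witt_structures \<xi> \<tau>) = 2 \<and> card (vir_structures \<xi> \<tau>) = 2) \<and>
        (\<tau> = 0 \<or> \<tau> = 1 \<longrightarrow>
           card (witt_structures \<xi> \<tau>) = 1 \<and> card (vir_structures \<xi> \<tau>) = 1))"
proof -
  note coset = assms(1) and s = assms(2)
  let ?R = "{x :: complex. (x - 1)\<^sup>2 - \<tau> = 0}"
  have roots: "?R = {1 + s, 1 - s}"
  proof -
    have "(x - 1)\<^sup>2 - \<tau> = 0 \<longleftrightarrow> x = 1 + s \<or> x = 1 - s" for x
      unfolding s[symmetric] right_minus_eq power2_eq_iff by (auto simp: algebra_simps)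
    then show ?thesis by auto
  qed
  have rho: "rho_witt \<xi> r \<in> witt_structures \<xi> \<tau> \<and> rho_vir \<xi> r \<in> vir_structures \<xi> \<tau>"
    if "r \<in> {s, - s}" "1 - r \<notin> \<xi>" for r
    using that s rho_witt_structure[OF coset _ that(2)] rho_vir_structure[OF coset _ that(2)] by auto
  have "vir_structures \<xi> \<tau> = {}" if R: "?R \<subseteq> \<xi>"
  proof (rule ccontr)
    assume "vir_structures \<xi> \<tau> \<noteq> {}"
    then obtain act where "act \<in> vir_structures \<xi> \<tau>"
      by blast
    then obtain r where "r \<in> {s, - s}" "1 - r \<notin> \<xi>"
      by (rule vir_structure_imp_root_notin[OF coset s])
    then show False
      using R unfolding roots by auto
  qed
  moreover have "witt_structures \<xi> \<tau> = {}" if "vir_structures \<xi> \<tau> = {}"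
    using that witt_structures_pullback by blast
  moreover have "?R \<subseteq> \<xi>" if "witt_structures \<xi> \<tau> = {} \<or> vir_structures \<xi> \<tau> = {}"
    using that rho[of s] rho[of "- s"] unfolding roots by auto
  ultimately have empty: "witt_structures \<xi> \<tau> = {} \<longleftrightarrow> ?R \<subseteq> \<xi>" "vir_structures \<xi> \<tau> = {} \<longleftrightarrow> ?R \<subseteq> \<xi>"
    by blast+
  have simple: "witt_structures \<xi> \<tau> = {rho_witt \<xi> s, rho_witt \<xi> (- s)} \<and>
        vir_structures \<xi> \<tau> = {rho_vir \<xi> s, rho_vir \<xi> (- s)} \<and>
        (\<tau> \<noteq> 0 \<and> \<tau> \<noteq> 1 \<longrightarrow>
           card (witt_structures \<xi> \<tau>) = 2 \<and> card (vir_structures \<xi> \<tau>) = 2) \<and>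
        (\<tau> = 0 \<or> \<tau> = 1 \<longrightarrow>
           card (witt_structures \<xi> \<tau>) = 1 \<and> card (vir_structures \<xi> \<tau>) = 1)"
    if "simple_lie_module pm_scale sl2_bracket pm_scale (dense_space \<xi>) (dense_act \<tau>)"
  proof -
    have nz: "\<tau> \<noteq> (\<mu> + 1)\<^sup>2" if "\<mu> \<in> \<xi>" for \<mu>
      using coset that \<open>simple_lie_module _ _ _ _ _\<close> by (rule simple_dense_imp_neq_square)
    have vir: "vir_structures \<xi> \<tau> = {rho_vir \<xi> s, rho_vir \<xi> (- s)}"
      by (rule vir_structures_simple(1)[OF coset s]) (rule nz)
    have eq_vir: "rho_vir \<xi> s = rho_vir \<xi> (- s) \<longleftrightarrow> \<tau> = 0 \<or> \<tau> = 1"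
      by (rule vir_structures_simple(2)[OF coset s]) (rule nz)
    have root: "1 - r \<notin> \<xi>" if "r \<in> {s, - s}" for r
      by (rule vir_structures_simple(3)[OF coset s _ that]) (rule nz)
    have "act \<in> {rho_witt \<xi> s, rho_witt \<xi> (- s)}" if "act \<in> witt_structures \<xi> \<tau>" for act
      using witt_structures_pullback[OF that] unfolding vir rho_vir_pullback
      by (simp only: pullback_inject insert_iff empty_iff)
    moreover have "rho_witt \<xi> r \<in> witt_structures \<xi> \<tau>" if "r \<in> {s, - s}" for r
      using rho[OF that root[OF that]] by blast
    ultimately have witt: "witt_structures \<xi> \<tau> = {rho_witt \<xi> s, rho_witt \<xi> (- s)}"
      by blast
    have eq: "rho_witt \<xi> s = rho_witt \<xi> (- s) \<longleftrightarrow> \<tau> = 0 \<or> \<tau> = 1"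
      using eq_vir unfolding rho_vir_pullback pullback_inject .
    have card: "card {a, b} = (if a = b then 1 else 2)" for a b :: 'c
      by simp
    show ?thesis
      unfolding witt vir card eq_vir eq by simp
  qed
  show ?thesis
  proof (intro conjI)
    show "?R = {1 + s, 1 - s}" by (rule roots)
    show "witt_structures \<xi> \<tau> = {} \<longleftrightarrow> ?R \<subseteq> \<xi>" "vir_structures \<xi> \<tau> = {} \<longleftrightarrow> ?R \<subseteq> \<xi>"
      by (rule empty)+
  qed (use rho simple in blast)+
qed

end
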